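(* The continuous level Monte Carlo (CLMC) estimator $$\widehat{Q}^{\mathrm{CLMC}}_{L_{\max}} := \frac{1}{N}\sum_{k=1}^{N}\int_0^{L_{\max}}\frac{1}{\mathbb{P}(L\ge \ell)}\left(\frac{\mathrm{d}Q}{\mathrm{d}\ell}\right)^{(k)}(\ell)\,\mathbf{1}_{[0,L^{(k)}]}(\ell)\,\mathrm{d}\ell$$ is an unbiased estimator for $\mathbb{E}[Q(L_{\max})-Q(0)]$, i.e. $$\mathbb{E}\big[\widehat{Q}^{\mathrm{CLMC}}_{L_{\max}}\big]=\mathbb{E}[Q(L_{\max})-Q(0)].$$
   Context: $\mathcal{Q}$ is a scalar random quantity of interest, and $(Q(\ell))_{\ell\ge 0}$ is a stochastic process of approximations of $\mathcal{Q}$, indexed by the continuous level of resolution $\ell$, with $Q(\ell)\to\mathcal{Q}$ almost surely as $\ell\to+\infty$. $L_{\max}\in[0,\infty]$ is a deterministic constant; when $L_{\max}=\infty$, $Q(L_{\max})$ means $\mathcal{Q}$. It is assumed that $Q\in W^{1,1}(0,L_{\max})$ as a function of $\ell$, where $W^{1,1}(0,L_{\max})$ is the Sobolev space of functions over $\ell\in(0,L_{\max})$ such that the functions and their weak first derivatives have finite $L^1$ norm; $\frac{\mathrm{d}Q}{\mathrm{d}\ell}$ denotes the derivative with respect to $\ell$. $L$ is a random variable with finite expectation (the random finest level of resolution), taking values in the levels $\ell\ge 0$, and independent of the whole stochastic process $(Q(\ell))_{\ell\ge 0}$; $\mathbb{P}(L\ge\ell)>0$ for $0\le\ell<L_{\max}$,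 so that the weight in the estimator is defined. The superscript $(k)$ denotes the $k$-th realisation (independent samples) of the respective random variable, $N$ is the total number of samples, and $\mathbf{1}_A$ is the indicator function of $A$.
   Formalization: The identity is proved whenever the CLMC estimator has a finite expectation, which holds if the expected L1 norm of dQ/dl is finite; pathwise W^{1,1} regularity alone does not guarantee that the expectation exists. Q is taken with continuous paths. *)

theory Defs
  imports "HOL-Probability.Probability"
begin

text \<open>
  The space of smooth functions on the real line whose (compact) support lies in \<open>U\<close>.
\<close>

definition test_functions :: "real set \<Rightarrow> (real \<Rightarrow> real) set" where
  "test_functions U =
     {\<phi>. (\<forall>n x. ((deriv ^^ n) \<phi>) field_differentiable at x) \<and>
          compact (closure {x. \<phi> x \<noteq> 0}) \<and> closure {x. \<phi> x \<noteq> 0} \<subseteq> U}"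

definition locally_integrable_on :: "(real \<Rightarrow> real) \<Rightarrow> real set \<Rightarrow> bool" where
  "locally_integrable_on f U \<longleftrightarrow> (\<forall>K. compact K \<and> K \<subseteq> U \<longrightarrow> f absolutely_integrable_on K)"

definition weak_derivative_on :: "real set \<Rightarrow> (real \<Rightarrow> real) \<Rightarrow> (real \<Rightarrow> real) \<Rightarrow> bool" where
  "weak_derivative_on U f g \<longleftrightarrow>
     locally_integrable_on f U \<and> locally_integrable_on g U \<and>
     (\<forall>\<phi>\<in>test_functions U.
        (LINT x:U|lebesgue. f x * deriv \<phi> x) = - (LINT x:U|lebesgue. g x * \<phi> x))"

definition sobolev_W11 :: "real set \<Rightarrow> (real \<Rightarrow> real) set" where
  "sobolev_W11 U =
     {f. f absolutely_integrable_on U \<and>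
         (\<exists>g. g absolutely_integrable_on U \<and> weak_derivative_on U f g)}"

definition value_at_level ::
  "(real \<Rightarrow> 'a \<Rightarrow> real) \<Rightarrow> ('a \<Rightarrow> real) \<Rightarrow> ereal \<Rightarrow> 'a \<Rightarrow> real" where
  "value_at_level Q Qinf l \<omega> = (if l = \<infinity> then Qinf \<omega> else Q (real_of_ereal l) \<omega>)"

text \<open>
  Random variables live on the probability space \<open>M\<close>. Independent samples are described by
  independent \<open>M\<close>-valued random elements \<open>\<xi> k\<close> of law \<open>M\<close> on a sampling space: the \<open>k\<close>-th
  realisation of a random variable \<open>X\<close> on \<open>M\<close> is \<open>X \<circ> \<xi> k\<close>. The argument \<open>dQ \<omega>\<close> is the
  derivative of the path of \<open>\<omega>\<close> with respect to the level, \<open>\<omega>\<close> in \<open>M\<close>.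
\<close>

definition clmc_estimator ::
  "'a measure \<Rightarrow> ('a \<Rightarrow> real) \<Rightarrow> ('a \<Rightarrow> real \<Rightarrow> real) \<Rightarrow> ereal \<Rightarrow> nat \<Rightarrow> (nat \<Rightarrow> 's \<Rightarrow> 'a) \<Rightarrow> 's \<Rightarrow> real"
  where
  "clmc_estimator M L dQ Lmax N \<xi> \<sigma> =
     (1 / real N) * (\<Sum>k=1..N.
        (LBINT l=0..Lmax. 1 / measure M {\<omega> \<in> space M. L \<omega> \<ge> l}
            * dQ (\<xi> k \<sigma>) l * indicator {0..L (\<xi> k \<sigma>)} l))"

text \<open>The sigma-algebra on \<open>space M\<close> generated by the whole process \<open>(Q l)\<close>, \<open>l \<ge> 0\<close>.\<close>

definition process_events :: "'a measure \<Rightarrow> (real \<Rightarrow> 'a \<Rightarrow> real) \<Rightarrow> 'a set set" where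
  "process_events M Q =
     sets (vimage_algebra (space M) (\<lambda>\<omega>. \<lambda>l\<in>{0..}. Q l \<omega>) (PiM {0..} (\<lambda>_. borel)))"

end

theory Submission
  imports Defs
begin

text \<open>
  Fix a path with derivative \<open>g\<close>. As \<open>P(L \<ge> l)\<close> is the mean of the indicator of \<open>l \<le> L\<close>,
  Fubini's theorem shows that averaging the integral of \<open>g(l) / P(L \<ge> l)\<close> over \<open>l \<le> x\<close> against
  the law of \<open>L\<close> in \<open>x\<close> gives the integral of \<open>g\<close>, with absolute values controlled by the
  \<open>L1\<close> norm of \<open>g\<close>, which is finite for almost every path. Continuity of the path and the weak
  derivative (tested against smoothed indicators of intervals) identify the integral of \<open>g\<close> with
  \<open>Q(Lmax) - Q(0)\<close>.

  To freeze the path one needs the integral to be a measurable function of \<open>L\<close> and of the process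
  alone, whereas \<open>dQ\<close> is not assumed measurable with respect to \<open>Q\<close>. This is obtained by writing
  it as a limit of Riemann-Stieltjes sums in \<open>Q\<close> with left endpoints; they converge because the
  weight \<open>1 / P(L \<ge> l)\<close>, cut off at \<open>L\<close>, is left-continuous and almost surely bounded.

  Conversely, an integrable sum of independent variables has integrable summands, so that
  integrability of the estimator passes to a single sample and then, by Fubini, to \<open>Q(Lmax) - Q(0)\<close>.
\<close>

subsection \<open>A smooth step function\<close>

text \<open>\<open>flat 0\<close> is the classical smooth function that is flat at 0. Powers of 1/x
  are carried along because differentiating exp(-1/x) produces them; this makes the linear span of
  the family closed under derivatives.\<close>

definition flat :: "nat \<Rightarrow> real \<Rightarrow> real" where
  "flat n x = (if x > 0 then exp (- (1 / x)) / x ^ n else 0)"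

lemma flat_tendsto_0: "(\<lambda>x. flat n x) \<midarrow>0\<rightarrow> 0"
proof -
  have "((\<lambda>x::real. (inverse x) ^ n / exp (inverse x)) \<longlongrightarrow> 0) (at_right 0)"
    by (rule filterlim_compose[OF tendsto_power_div_exp_0 filterlim_inverse_at_top_right])
  then have r: "(flat n \<longlongrightarrow> 0) (at_right 0)"
    by (rule Lim_transform_eventually)
      (auto simp: eventually_at_right_field flat_def exp_minus field_simps intro!: exI[of _ 1])
  have l: "(flat n \<longlongrightarrow> 0) (at_left 0)"
    by (rule tendsto_eventually) (auto simp: eventually_at_left_field flat_def intro!: exI[of _ "-1"])
  show ?thesis
    using filterlim_split_at[OF l r] .
qed

lemma DERIV_flat: "(flat n has_real_derivative flat (n + 2) x - n * flat (n + 1) x) (at x)"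
proof -
  consider "x > 0" | "x < 0" | "x = 0" by linarith
  then show ?thesis
  proof cases
    case 1
    have "((\<lambda>x. exp (- (1 / x)) / x ^ n) has_real_derivative flat (n + 2) x - n * flat (n + 1) x) (at x)"
    proof (rule DERIV_cong)
      show "((\<lambda>x. exp (- (1 / x)) / x ^ n) has_real_derivative
          (exp (- (1 / x)) * (1 / x\<^sup>2) * x ^ n - exp (- (1 / x)) * (n * x ^ (n - 1))) / (x ^ n * x ^ n)) (at x)"
        using 1 by (auto intro!: derivative_eq_intros simp: power2_eq_square)
      \<comment> \<open>For n = 0 the exponent is truncated, but the factor n makes both sides
        0.\<close>
      have "n * x ^ (n - 1) = n * (x ^ n / x)"
        using 1 by (cases n) auto
      then show "(exp (- (1 / x)) * (1 / x\<^sup>2) * x ^ n - exp (- (1 / x)) * (n * x ^ (n - 1))) / (x ^ n * x ^ n) =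
          flat (n + 2) x - n * flat (n + 1) x"
        using 1 by (simp add: flat_def field_simps power2_eq_square) auto
    qed
    then show ?thesis
      by (rule has_field_derivative_transform_within_open[where S="{0<..}"])
        (use 1 in \<open>auto simp: flat_def\<close>)
  next
    case 2
    have "((\<lambda>x. 0) has_real_derivative flat (n + 2) x - n * flat (n + 1) x) (at x)"
      using 2 by (auto simp: flat_def)
    then show ?thesis
      by (rule has_field_derivative_transform_within_open[where S="{..<0}"])
        (use 2 in \<open>auto simp: flat_def\<close>)
  next
    case 3
    \<comment> \<open>Away from 0 the difference quotient at 0 is \<open>flat (n + 1)\<close>
      itself.\<close>
    have "(\<lambda>h. flat n h / h) \<midarrow>0\<rightarrow> 0"
      by (rule Lim_transform_eventually[OF flat_tendsto_0[of "n + 1"]])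
        (auto simp: flat_def eventually_at_filter)
    then show ?thesis
      by (simp add: 3 DERIV_def flat_def)
  qed
qed

text \<open>Closed under differentiation, hence consisting of smooth functions.\<close>

inductive flat_algebra :: "(real \<Rightarrow> real) \<Rightarrow> bool" where
  const: "flat_algebra (\<lambda>x. c)"
| flat: "flat_algebra (\<lambda>x. flat n (a * x + b))"
| add: "flat_algebra f \<Longrightarrow> flat_algebra g \<Longrightarrow> flat_algebra (\<lambda>x. f x + g x)"
| mult: "flat_algebra f \<Longrightarrow> flat_algebra g \<Longrightarrow> flat_algebra (\<lambda>x. f x * g x)"

lemma flat_algebra_DERIV:
  "flat_algebra f \<Longrightarrow> \<exists>g. flat_algebra g \<and> (\<forall>x. (f has_real_derivative g x) (at x))"
proof (induction rule: flat_algebra.induct)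
  case (const c)
  show ?case by (rule exI[of _ "\<lambda>x. 0"]) (auto intro: flat_algebra.const)
next
  case (flat n a b)
  have "flat_algebra (\<lambda>x. a * (flat (n + 2) (a * x + b) + (- real n) * flat (n + 1) (a * x + b)))"
    by (intro flat_algebra.intros)
  moreover have "((\<lambda>x. flat n (a * x + b)) has_real_derivative
      a * (flat (n + 2) (a * x + b) + (- real n) * flat (n + 1) (a * x + b))) (at x)" for x
    by (rule DERIV_cong[OF DERIV_chain2[OF DERIV_flat]]) (auto intro!: derivative_eq_intros)
  ultimately show ?case by blast
next
  case (add f g)
  then obtain f' g' where "flat_algebra f'" "flat_algebra g'"
    "\<forall>x. (f has_real_derivative f' x) (at x)" "\<forall>x. (g has_real_derivative g' x) (at x)" by blast
  then show ?case
    by (intro exI[of _ "\<lambda>x. f' x + g' x"]) (auto intro!: flat_algebra.add derivative_intros)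
next
  case (mult f g)
  then obtain f' g' where *: "flat_algebra f'" "flat_algebra g'"
    "\<forall>x. (f has_real_derivative f' x) (at x)" "\<forall>x. (g has_real_derivative g' x) (at x)" by blast
  have "flat_algebra (\<lambda>x. f x * g' x + f' x * g x)"
    using mult * by (intro flat_algebra.intros)
  with * show ?case
    by (intro exI[of _ "\<lambda>x. f x * g' x + f' x * g x"]) (auto intro!: DERIV_mult')
qed

lemma flat_algebra_deriv: "flat_algebra f \<Longrightarrow> flat_algebra (deriv f)"
  using flat_algebra_DERIV[of f] by (metis DERIV_imp_deriv ext)

lemma flat_algebra_smooth:
  assumes "flat_algebra f"
  shows "((deriv ^^ n) f) field_differentiable at x"
proof -
  have "flat_algebra ((deriv ^^ n) f)"
    by (induction n) (use assms in \<open>auto intro: flat_algebra_deriv\<close>)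
  then show ?thesis
    using flat_algebra_DERIV field_differentiable_def by blast
qed

lemma flat_algebra_continuous: "flat_algebra f \<Longrightarrow> continuous_on S f"
  by (meson DERIV_continuous_on flat_algebra_DERIV has_field_derivative_at_within)

text \<open>The cut-off functions used below are primitives of elements of
  \<open>flat_algebra\<close>, not built inside it. Only their derivatives of positive order are
  known to lie there, so order 0 is treated apart.\<close>

lemma smooth_if_DERIV_flat_algebra:
  assumes "\<And>x. (F has_real_derivative f x) (at x)" "flat_algebra f"
  shows "((deriv ^^ n) F) field_differentiable at x"
proof (cases n)
  case 0
  then show ?thesis using assms(1) field_differentiable_def by auto
next
  case (Suc m)
  have "deriv F = f" using assms(1) by (metis DERIV_imp_deriv ext)
  then show ?thesis
    using flat_algebra_smooth[OF assms(2), of m x]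
    by (simp add: Suc funpow_Suc_right del: funpow.simps)
qed

lemma flat_algebra_affine: "flat_algebra f \<Longrightarrow> flat_algebra (\<lambda>x. f (a * x + b))"
proof (induction rule: flat_algebra.induct)
  case (flat n c d)
  have "flat_algebra (\<lambda>x. flat n ((c * a) * x + (c * b + d)))" by (rule flat_algebra.flat)
  then show ?case by (simp add: algebra_simps)
qed (auto intro: flat_algebra.intros)

text \<open>The bump exp(-1/x) exp(-1/(1-x)) on (0, 1), divided by its integral, is e, and E is its
  primitive. Below, e serves as a mollifier and E as a smoothed Heaviside function.\<close>

lemma smooth_step:
  obtains e E :: "real \<Rightarrow> real" where
    "flat_algebra e" "\<And>x. (E has_real_derivative e x) (at x)"
    "\<And>x. e x \<ge> 0" "\<And>x. x \<notin> {0<..<1} \<Longrightarrow> e x = 0"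
    "\<And>x. x \<le> 0 \<Longrightarrow> E x = 0" "\<And>x. x \<ge> 1 \<Longrightarrow> E x = 1" "\<And>x. 0 \<le> E x" "\<And>x. E x \<le> 1"
    "(e has_integral 1) {0..1}"
proof -
  define B where "B x = flat 0 (1 * x + 0) * flat 0 ((-1) * x + 1)" for x
  have B: "flat_algebra B"
    unfolding B_def by (intro flat_algebra.intros)
  have B0: "B x \<ge> 0" for x by (simp add: B_def flat_def)
  have Bz: "B x = 0" if "x \<notin> {0<..<1}" for x using that by (auto simp: B_def flat_def)
  have Bp: "B x > 0" if "x \<in> {0<..<1}" for x using that by (auto simp: B_def flat_def)
  \<comment> \<open>Starting at -1, left of the support, makes every point above -1 interior to an
    interval of integration; further left P vanishes identically.\<close>
  define P where "P x = integral {-1..x} B" for x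
  have P: "(P has_real_derivative B x) (at x)" if "x > -1" for x
  proof -
    have "(P has_real_derivative B x) (at x within {-1..x+1})"
      unfolding P_def
      by (rule integral_has_real_derivative) (use that in \<open>auto intro!: flat_algebra_continuous B\<close>)
    then show ?thesis
      using that by (subst (asm) at_within_interior) (auto simp: interior_atLeastAtMost_real)
  qed
  have P0: "P x = 0" if "x \<le> 0" for x
    unfolding P_def using that
    by (intro integral_unique has_integral_is_0) (auto simp: Bz)
  have PD: "(P has_real_derivative B x) (at x)" for x
  proof (cases "x > -1")
    case False
    have "((\<lambda>x. 0) has_real_derivative B x) (at x)" using False by (simp add: Bz)
    then show ?thesis
      by (rule has_field_derivative_transform_within_open[where S="{..<0}"])
        (use False in \<open>auto simp: P0\<close>)
  qed (rule P)
  have mono: "P x \<le> P y" if "x \<le> y" for x y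
    using DERIV_nonneg_imp_nondecreasing[OF that] PD B0 by blast
  define c where "c = P 1"
  \<comment> \<open>The normalising constant is positive: P is monotone, and strictly increasing
    where the bump is positive.\<close>
  have "P (1/4) < P (1/2)"
  proof (rule DERIV_pos_imp_increasing[where f=P])
    fix x :: real assume "1/4 \<le> x" "x \<le> 1/2"
    then have "B x > 0" by (intro Bp) auto
    with PD show "\<exists>y. (P has_real_derivative y) (at x) \<and> y > 0" by blast
  qed simp
  then have c: "c > 0" using mono[of 0 "1/4"] mono[of "1/2" 1] P0[of 0] by (simp add: c_def)
  have P1: "P x = c" if "x \<ge> 1" for x
  proof -
    have "P x = P 1"
    proof (rule DERIV_isconst2[where f=P and b="x + 1"])
      show "1 < x + 1" using that by simp
      show "continuous_on {1..x+1} P" by (meson DERIV_continuous_on PD has_field_derivative_at_within)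
      show "(P has_real_derivative 0) (at y)" if "1 < y" "y < x + 1" for y
        using PD[of y] Bz[of y] that by simp
    qed (use that in auto)
    then show ?thesis by (simp add: c_def)
  qed
  show ?thesis
  proof
    show "flat_algebra (\<lambda>x. (1 / c) * B x)" by (intro flat_algebra.mult flat_algebra.const B)
    show D: "((\<lambda>x. (1 / c) * P x) has_real_derivative (1 / c) * B x) (at x)" for x
      by (intro DERIV_cmult PD)
    show "0 \<le> 1 / c * B x" for x using c B0 by simp
    show "x \<notin> {0<..<1} \<Longrightarrow> 1 / c * B x = 0" for x by (simp add: Bz)
    show "x \<le> 0 \<Longrightarrow> 1 / c * P x = 0" for x by (simp add: P0)
    show "1 \<le> x \<Longrightarrow> 1 / c * P x = 1" for x using c by (simp add: P1)
    show "0 \<le> 1 / c * P x" for x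
      using c mono[of 0 x] P0[of 0] P0[of x] by (cases "x \<le> 0") auto
    show "1 / c * P x \<le> 1" for x
      using c mono[of x 1] P1[of 1] P1[of x] by (cases "x \<le> 1") (auto simp: field_simps)
    have "((\<lambda>x. (1 / c) * B x) has_integral (1 / c) * P 1 - (1 / c) * P 0) {0..1}"
      by (rule fundamental_theorem_of_calculus)
        (use D in \<open>auto simp: has_real_derivative_iff_has_vector_derivative[symmetric] intro: has_field_derivative_at_within\<close>)
    then show "((\<lambda>x. (1 / c) * B x) has_integral 1) {0..1}"
      using c by (simp add: P0 P1)
  qed
qed

subsection \<open>Weak derivatives and the fundamental theorem of calculus\<close>

text \<open>The substitution x = c + y / (n + 1) turns the integral into an average of f (c + y / (n
  + 1)) with weight e, and dominated convergence applies. The kernel sits to the right of c, so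
  continuity on [c, d] suffices.\<close>

lemma mollifier_tendsto:
  fixes f e :: "real \<Rightarrow> real"
  assumes "c < d" and f: "continuous_on {c..d} f" and e: "continuous_on UNIV e"
    and e0: "\<And>x. 0 \<le> e x" and ez: "\<And>x. x \<notin> {0<..<1} \<Longrightarrow> e x = 0"
    and e1: "(e has_integral 1) {0..1}"
  shows "(\<lambda>n. LBINT x:{c..d}. f x * (real (Suc n) * e (real (Suc n) * (x - c)))) \<longlonglongrightarrow> f c"
proof -
  \<comment> \<open>Extended by zero, f is a bounded Borel function on the whole line, so that the
    substitution is global.\<close>
  define fh where "fh x = indicator {c..d} x *\<^sub>R f x" for x
  have [measurable]: "fh \<in> borel_measurable borel"
    unfolding fh_def using f by (intro borel_measurable_continuous_on_indicator) auto
  have [measurable]: "e \<in> borel_measurable borel"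
    using e by (intro borel_measurable_continuous_onI)
  obtain B where B: "\<And>x. x \<in> {c..d} \<Longrightarrow> norm (f x) \<le> B"
    using compact_imp_bounded[OF compact_continuous_image[OF f compact_Icc]] by (fastforce simp: bounded_iff)
  have "0 \<le> B" using B[of c] \<open>c < d\<close> by (smt (verit) atLeastAtMost_iff norm_ge_zero)
  then have Bh: "norm (fh x) \<le> B" for x using B by (auto simp: fh_def indicator_def)
  have e_on: "indicator {0..1} x *\<^sub>R e x = e x" for x
    using ez[of x] by (cases "x \<in> {0<..<1}") (auto simp: indicator_def)
  have "set_integrable lborel {0..1} e"
    using e by (intro borel_integrable_atLeastAtMost') (auto intro: continuous_on_subset)
  from this set_borel_integral_eq_integral(2)[OF this] integral_unique[OF e1]
  have ei: "integrable lborel e" and eI: "(\<integral>x. e x \<partial>lborel) = 1"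
    by (simp_all add: set_integrable_def set_lebesgue_integral_def e_on del: real_scaleR_def)
  have eq: "(LBINT x:{c..d}. f x * (real (Suc n) * e (real (Suc n) * (x - c)))) =
      (\<integral>y. fh (c + 1 / real (Suc n) * y) * e y \<partial>lborel)" for n
    unfolding set_lebesgue_integral_def
    by (subst lborel_integral_real_affine[where c="1 / real (Suc n)" and t=c])
      (auto simp: fh_def mult.assoc mult.left_commute simp del: of_nat_Suc
        simp flip: Bochner_Integration.integral_mult_right_zero intro!: Bochner_Integration.integral_cong)
  have "(\<lambda>n. \<integral>y. fh (c + 1 / real (Suc n) * y) * e y \<partial>lborel) \<longlonglongrightarrow> (\<integral>y. f c * e y \<partial>lborel)"
  proof (rule integral_dominated_convergence[where w="\<lambda>y. B * e y"])
    show "AE y in lborel. (\<lambda>n. fh (c + 1 / real (Suc n) * y) * e y) \<longlonglongrightarrow> f c * e y"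
    proof (rule AE_I2)
      fix y :: real
      show "(\<lambda>n. fh (c + 1 / real (Suc n) * y) * e y) \<longlonglongrightarrow> f c * e y"
      proof (cases "y \<in> {0<..<1}")
        case True
        have lim: "(\<lambda>n. c + 1 / real (Suc n) * y) \<longlonglongrightarrow> c + 0 * y"
          by (intro tendsto_intros LIMSEQ_Suc lim_1_over_n)
        then have "\<forall>\<^sub>F n in sequentially. c + 1 / real (Suc n) * y < d"
          using \<open>c < d\<close> by (intro order_tendstoD) auto
        then have ev: "\<forall>\<^sub>F n in sequentially. c + 1 / real (Suc n) * y \<in> {c..d}"
          by eventually_elim (use True in \<open>auto simp del: of_nat_Suc\<close>)
        have "(\<lambda>n. f (c + 1 / real (Suc n) * y)) \<longlonglongrightarrow> f c"
          by (rule continuous_on_tendsto_compose[OF f _ _ ev]) (use lim \<open>c < d\<close> in auto)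
        then have "(\<lambda>n. fh (c + 1 / real (Suc n) * y)) \<longlonglongrightarrow> f c"
          by (rule Lim_transform_eventually) (use ev in eventually_elim, auto simp: fh_def)
        then show ?thesis by (intro tendsto_intros)
      qed (simp add: ez)
    qed
    show "AE y in lborel. norm (fh (c + 1 / real (Suc n) * y) * e y) \<le> B * e y" for n
      using Bh by (auto simp: abs_mult e0 intro!: mult_right_mono)
  qed (use ei in auto)
  then show ?thesis by (simp add: eq eI del: of_nat_Suc)
qed

text \<open>The weak identity is tested with smooth trapezoids that rise from 0 to 1 just after a
  and fall back just after b. Their derivatives are differences of two mollifiers, which pick out f
  a - f b, while the trapezoids themselves tend to the indicator of (a, b].\<close>

lemma weak_derivative_FTC:
  assumes "open U" "a \<le> b" "{a..b} \<subseteq> U"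
    and wd: "weak_derivative_on U f g" and f: "continuous_on U f"
  shows "(LINT x:{a<..b}|lebesgue. g x) = f b - f a"
proof (cases "a = b")
  case False
  then have "a < b" using assms by simp
  obtain r where "r > 0" "ball b r \<subseteq> U"
    using assms by (meson atLeastAtMost_iff openE order_refl subsetD)
  \<comment> \<open>The falling ramp lies to the right of b, so room is needed there inside U;
    \<open>{a..d}\<close> will contain the supports.\<close>
  define d where "d = b + r / 2"
  have "b < d" using \<open>r > 0\<close> by (simp add: d_def)
  have "{a..d} \<subseteq> U"
  proof
    fix x assume "x \<in> {a..d}"
    then show "x \<in> U"
      using assms(3) \<open>ball b r \<subseteq> U\<close> \<open>r > 0\<close>
      by (cases "x \<le> b") (auto simp: d_def dist_real_def subset_iff)
  qed
  with f have fd: "continuous_on {a..d} f" by (rule continuous_on_subset)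
  have gd: "set_integrable lebesgue {a..d} g"
    using wd \<open>{a..d} \<subseteq> U\<close> by (auto simp: weak_derivative_on_def locally_integrable_on_def)
  obtain e E :: "real \<Rightarrow> real" where e: "flat_algebra e" and E: "\<And>x. (E has_real_derivative e x) (at x)"
    and e0: "\<And>x. e x \<ge> 0" and ez: "\<And>x. x \<notin> {0<..<1} \<Longrightarrow> e x = 0"
    and E0: "\<And>x. x \<le> 0 \<Longrightarrow> E x = 0" and E1: "\<And>x. x \<ge> 1 \<Longrightarrow> E x = 1"
    and E01: "\<And>x. 0 \<le> E x" "\<And>x. E x \<le> 1" and eI: "(e has_integral 1) {0..1}"
    by (rule smooth_step) blast
  have ec: "continuous_on S e" for S using e by (rule flat_algebra_continuous)
  have Ec: "continuous_on S E" for S by (meson DERIV_continuous_on E has_field_derivative_at_within)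
  define k where "k c n x = real (Suc n) * e (real (Suc n) * (x - c))" for c n x
  define \<phi> where "\<phi> n x = E (real (Suc n) * (x - a)) - E (real (Suc n) * (x - b))" for n x
  have D\<phi>: "(\<phi> n has_real_derivative k a n x - k b n x) (at x)" for n x
    unfolding \<phi>_def k_def
    by (intro DERIV_diff DERIV_cong[OF DERIV_chain2[OF E]])
      (auto intro!: derivative_eq_intros simp del: of_nat_Suc)
  then have d\<phi>: "deriv (\<phi> n) x = k a n x - k b n x" for n x by (rule DERIV_imp_deriv)
  \<comment> \<open>From \<open>n0\<close> on, the ramp of width 1 / (n + 1) that starts at b ends
    before d.\<close>
  obtain n0 where n0: "inverse (real (Suc n0)) < d - b"
    using reals_Archimedean[of "d - b"] \<open>b < d\<close> by auto
  have small: "1 / real (Suc n) < d - b" if "n \<ge> n0" for n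
    using that by (intro order.strict_trans1[OF _ n0]) (auto simp: field_simps)
  have large: "real (Suc n) * (x - b) \<ge> 1" "real (Suc n) * (x - a) \<ge> 1" if "n \<ge> n0" "x \<ge> d" for n x
  proof -
    have "1 \<le> real (Suc n) * (d - b)"
      using small[OF that(1)] by (simp add: field_simps del: of_nat_Suc)
    also have "\<dots> \<le> real (Suc n) * (x - b)" using that by (intro mult_left_mono) auto
    finally show *: "real (Suc n) * (x - b) \<ge> 1" .
    also have "real (Suc n) * (x - b) \<le> real (Suc n) * (x - a)"
      using \<open>a < b\<close> by (intro mult_left_mono) auto
    finally show "real (Suc n) * (x - a) \<ge> 1" .
  qed
  have neg: "real (Suc n) * (x - c) \<le> 0" if "x \<le> c" for n x c
    using that by (intro mult_nonneg_nonpos) auto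
  have \<phi>z: "\<phi> n x = 0" if "n \<ge> n0" "x \<notin> {a..d}" for n x
    using that large[of n x] neg[of x a n] neg[of x b n] \<open>a < b\<close>
    by (cases "x < a") (auto simp: \<phi>_def E0 E1 simp del: of_nat_Suc)
  have kz: "k a n x - k b n x = 0" if "n \<ge> n0" "x \<notin> {a..d}" for n x
    using that large[of n x] neg[of x a n] neg[of x b n] \<open>a < b\<close>
    by (cases "x < a") (auto simp: k_def ez simp del: of_nat_Suc)
  have test: "\<phi> n \<in> test_functions U" if "n \<ge> n0" for n
  proof -
    have "flat_algebra (\<lambda>x. real (Suc n) * e (real (Suc n) * x + (- real (Suc n) * a)) +
        (-1) * (real (Suc n) * e (real (Suc n) * x + (- real (Suc n) * b))))"
      by (intro flat_algebra.add flat_algebra.mult flat_algebra.const flat_algebra_affine e)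
    then have "flat_algebra (\<lambda>x. k a n x - k b n x)"
      by (simp add: k_def algebra_simps del: of_nat_Suc)
    then have "((deriv ^^ m) (\<phi> n)) field_differentiable at x" for m x
      by (rule smooth_if_DERIV_flat_algebra[OF D\<phi>])
    moreover have "closure {x. \<phi> n x \<noteq> 0} \<subseteq> {a..d}"
      using \<phi>z[OF that] by (intro closure_minimal subsetI closed_atLeastAtMost) blast
    moreover from this have "compact (closure {x. \<phi> n x \<noteq> 0})"
      by (meson bounded_closed_interval bounded_subset closed_closure compact_eq_bounded_closed)
    ultimately show ?thesis
      using \<open>{a..d} \<subseteq> U\<close> by (auto simp: test_functions_def)
  qed
  have ki: "set_integrable lborel {a..d} (\<lambda>x. f x * k c n x)" for c n
    unfolding k_def by (intro borel_integrable_atLeastAtMost' continuous_intros fd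
      continuous_on_compose2[OF ec[of UNIV]]) auto
  have L: "(LINT x:U|lebesgue. f x * deriv (\<phi> n) x) =
      (LBINT x:{a..d}. f x * k a n x) - (LBINT x:{b..d}. f x * k b n x)" if "n \<ge> n0" for n
  proof -
    have "(LINT x:U|lebesgue. f x * deriv (\<phi> n) x) = (LINT x:{a..d}|lebesgue. f x * (k a n x - k b n x))"
      using kz[OF that] \<open>{a..d} \<subseteq> U\<close> unfolding set_lebesgue_integral_def d\<phi>
      by (intro Bochner_Integration.integral_cong) (auto simp: indicator_def)
    also have "\<dots> = (LBINT x:{a..d}. f x * k a n x - f x * k b n x)"
      unfolding set_lebesgue_integral_def right_diff_distrib
      using ki[of a n] ki[of b n]
      by (intro integral_completion) (auto simp: set_integrable_def right_diff_distrib)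
    also have "\<dots> = (LBINT x:{a..d}. f x * k a n x) - (LBINT x:{a..d}. f x * k b n x)"
      by (intro set_integral_diff ki)
    \<comment> \<open>The kernel at b vanishes to the left of b; cutting the domain there fits
      \<open>mollifier_tendsto\<close> with c = b.\<close>
    also have "(LBINT x:{a..d}. f x * k b n x) = (LBINT x:{b..d}. f x * k b n x)"
      unfolding set_lebesgue_integral_def
    proof (intro Bochner_Integration.integral_cong refl)
      fix x
      show "indicator {a..d} x *\<^sub>R (f x * k b n x) = indicator {b..d} x *\<^sub>R (f x * k b n x)"
        using \<open>a < b\<close> neg[of x b n] by (cases "x < b") (auto simp: indicator_def k_def ez)
    qed
    finally show ?thesis .
  qed
  have "(\<lambda>n. (LBINT x:{a..d}. f x * k a n x) - (LBINT x:{b..d}. f x * k b n x)) \<longlonglongrightarrow> f a - f b"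
    unfolding k_def
    by (intro tendsto_diff mollifier_tendsto[OF _ _ ec e0 ez eI])
      (use \<open>a < b\<close> \<open>b < d\<close> fd in \<open>auto intro: continuous_on_subset\<close>)
  then have lim1: "(\<lambda>n. LINT x:U|lebesgue. f x * deriv (\<phi> n) x) \<longlonglongrightarrow> f a - f b"
    by (rule Lim_transform_eventually) (use L in \<open>auto simp: eventually_sequentially intro!: exI[of _ n0]\<close>)
  have R: "(LINT x:U|lebesgue. g x * \<phi> n x) = (\<integral>x. (indicator {a..d} x *\<^sub>R g x) * \<phi> n x \<partial>lebesgue)"
    if "n \<ge> n0" for n
    using \<phi>z[OF that] \<open>{a..d} \<subseteq> U\<close> unfolding set_lebesgue_integral_def
    by (intro Bochner_Integration.integral_cong) (auto simp: indicator_def)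
  have "(\<lambda>n. \<integral>x. (indicator {a..d} x *\<^sub>R g x) * \<phi> n x \<partial>lebesgue) \<longlonglongrightarrow>
      (\<integral>x. indicator {a<..b} x *\<^sub>R (indicator {a..d} x *\<^sub>R g x) \<partial>lebesgue)"
  proof (rule integral_dominated_convergence[where w="\<lambda>x. norm (indicator {a..d} x *\<^sub>R g x)"])
    have gm[measurable]: "(\<lambda>x. indicator {a..d} x *\<^sub>R g x) \<in> borel_measurable lebesgue"
      using gd by (auto simp: set_integrable_def)
    have "\<phi> n \<in> borel_measurable borel" for n
      unfolding \<phi>_def
      by (intro borel_measurable_continuous_onI continuous_intros continuous_on_compose2[OF Ec[of UNIV]]) auto
    then have [measurable]: "\<phi> n \<in> borel_measurable lebesgue" for n
      by (simp add: measurable_completion)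
    show "(\<lambda>x. (indicator {a..d} x *\<^sub>R g x) * \<phi> n x) \<in> borel_measurable lebesgue" for n
      by measurable
    show "(\<lambda>x. indicator {a<..b} x *\<^sub>R (indicator {a..d} x *\<^sub>R g x)) \<in> borel_measurable lebesgue"
      by (rule borel_measurable_scaleR[OF borel_measurable_indicator gm]) auto
    show "integrable lebesgue (\<lambda>x. norm (indicator {a..d} x *\<^sub>R g x))"
      using gd unfolding set_integrable_def by (rule integrable_norm)
    show "AE x in lebesgue. norm ((indicator {a..d} x *\<^sub>R g x) * \<phi> n x) \<le> norm (indicator {a..d} x *\<^sub>R g x)" for n
    proof (rule AE_I2)
      fix x
      have "\<bar>\<phi> n x\<bar> \<le> 1" unfolding \<phi>_def using E01 by (smt (verit))
      then show "norm ((indicator {a..d} x *\<^sub>R g x) * \<phi> n x) \<le> norm (indicator {a..d} x *\<^sub>R g x)"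
        by (simp add: abs_mult mult_left_le)
    qed
    show "AE x in lebesgue. (\<lambda>n. (indicator {a..d} x *\<^sub>R g x) * \<phi> n x) \<longlonglongrightarrow>
        indicator {a<..b} x *\<^sub>R (indicator {a..d} x *\<^sub>R g x)"
    proof (rule AE_I2)
      fix x
      \<comment> \<open>At x = c the value is E 0 = 0, which is why the limiting interval is open at
        a and closed at b.\<close>
      have one: "(\<lambda>n. E (real (Suc n) * (x - c))) \<longlonglongrightarrow> (if c < x then 1 else 0)" for c
      proof (cases "c < x")
        case True
        have "filterlim (\<lambda>n. real (Suc n) * (x - c)) at_top sequentially"
          using True by (intro filterlim_at_top_mult_tendsto_pos[OF tendsto_const] filterlim_compose[OF filterlim_real_sequentially] filterlim_Suc) auto
        then have "\<forall>\<^sub>F n in sequentially. real (Suc n) * (x - c) \<ge> 1"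
          by (simp add: filterlim_at_top)
        then show ?thesis
          using True by (intro tendsto_eventually) (auto elim!: eventually_mono simp: E1 simp del: of_nat_Suc)
      next
        case False
        then show ?thesis using neg[of x c] by (simp add: E0 del: of_nat_Suc)
      qed
      have "(\<lambda>n. \<phi> n x) \<longlonglongrightarrow> (if a < x then 1 else 0) - (if b < x then 1 else 0)"
        unfolding \<phi>_def by (intro tendsto_diff one)
      also have "(if a < x then 1 else 0) - (if b < x then 1 else 0) = (indicator {a<..b} x :: real)"
        using \<open>a < b\<close> by (auto simp: indicator_def)
      finally have "(\<lambda>n. (indicator {a..d} x *\<^sub>R g x) * \<phi> n x) \<longlonglongrightarrow>
          (indicator {a..d} x *\<^sub>R g x) * indicator {a<..b} x"
        by (intro tendsto_mult tendsto_const)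
      then show "(\<lambda>n. (indicator {a..d} x *\<^sub>R g x) * \<phi> n x) \<longlonglongrightarrow>
          indicator {a<..b} x *\<^sub>R (indicator {a..d} x *\<^sub>R g x)"
        by (simp add: mult.commute)
    qed
  qed
  also have "(\<integral>x. indicator {a<..b} x *\<^sub>R (indicator {a..d} x *\<^sub>R g x) \<partial>lebesgue) = (LINT x:{a<..b}|lebesgue. g x)"
    unfolding set_lebesgue_integral_def using \<open>b < d\<close>
    by (intro Bochner_Integration.integral_cong) (auto simp: indicator_def)
  finally have "(\<lambda>n. - (LINT x:U|lebesgue. g x * \<phi> n x)) \<longlonglongrightarrow> - (LINT x:{a<..b}|lebesgue. g x)"
    by (intro tendsto_minus, rule Lim_transform_eventually) (use R in \<open>auto simp: eventually_sequentially intro!: exI[of _ n0]\<close>)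
  then have lim2: "(\<lambda>n. LINT x:U|lebesgue. f x * deriv (\<phi> n) x) \<longlonglongrightarrow> - (LINT x:{a<..b}|lebesgue. g x)"
    by (rule Lim_transform_eventually)
      (use wd test in \<open>auto simp: eventually_sequentially weak_derivative_on_def intro!: exI[of _ n0]\<close>)
  show ?thesis
    using LIMSEQ_unique[OF lim1 lim2] by simp
qed (simp add: set_lebesgue_integral_def)

section \<open>Almost everywhere uniqueness and integrability of weak derivatives\<close>

lemma AE_zero_if_integrals_Ioc_zero:
  fixes h :: "real \<Rightarrow> real"
  assumes h: "set_integrable lebesgue {a..b} h"
    and z: "\<And>c d. a \<le> c \<Longrightarrow> c \<le> d \<Longrightarrow> d \<le> b \<Longrightarrow> (LINT x:{c<..d}|lebesgue. h x) = 0"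
  shows "AE x in lebesgue. x \<in> {a..b} \<longrightarrow> h x = 0"
proof -
  let ?h = "\<lambda>x. indicator {a..b} x *\<^sub>R h x"
  have hi: "integrable lebesgue ?h" using h by (simp add: set_integrable_def)
  then have hm: "?h \<in> borel_measurable lebesgue" by auto
  \<comment> \<open>A Borel representative of the truncated h lets the argument run over Borel
    sets.\<close>
  then obtain k where k[measurable]: "k \<in> borel_measurable lborel" and "AE x in lborel. ?h x = k x"
    using completion_ex_borel_measurable_real[OF hm] by blast
  then have ae: "AE x in lebesgue. ?h x = k x" by (simp add: AE_completion)
  have km: "k \<in> borel_measurable lebesgue" using k by (rule measurable_completion)
  have ki: "integrable lborel k"
    using integrable_cong_AE_imp[OF hi km] ae integrable_completion[OF k] by (auto simp: eq_commute)
  have eq: "(LBINT x:A. k x) = (LINT x:A|lebesgue. ?h x)" if "A \<in> sets borel" for A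
  proof -
    have "(LINT x:A|lebesgue. ?h x) = (LINT x:A|lebesgue. k x)"
      by (rule set_lebesgue_integral_cong_AE[OF _ hm km]) (use ae that in auto)
    also have "\<dots> = (LBINT x:A. k x)"
      unfolding set_lebesgue_integral_def using that by (intro integral_completion) auto
    finally show ?thesis by simp
  qed
  have Ioc: "(LBINT x:{c<..d}. k x) = 0" if "c \<le> d" for c d
  proof -
    have "(LBINT x:{c<..d}. k x) = (LINT x:{c<..d}|lebesgue. ?h x)" by (rule eq) simp
    \<comment> \<open>Cutting (c, d] to [a, b] may keep the point a when c < a; this is a null
      set.\<close>
    also have "\<dots> = (LINT x:{max a c<..min b d}|lebesgue. h x)"
      unfolding set_lebesgue_integral_def
      by (rule integral_discrete_difference[where X="{a}"]) (auto simp: indicator_def)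
    also have "\<dots> = 0"
    proof (cases "max a c \<le> min b d")
      case False
      then have "{max a c<..min b d} = {}" by auto
      then show ?thesis by (simp only: set_lebesgue_integral_def) simp
    qed (auto intro!: z)
    finally show ?thesis .
  qed
  have Icc: "(LBINT x:{c..d}. k x) = 0" if "c \<le> d" for c d
    by (subst set_integral_discrete_difference[where X="{c}" and B="{c<..d}"]) (use Ioc[OF that] in auto)
  \<comment> \<open>The total integral is what the complement case of the induction over Borel sets
    uses.\<close>
  have tot: "(\<integral>x. k x \<partial>lborel) = 0"
  proof -
    have "(\<integral>x. k x \<partial>lborel) = (LINT x:UNIV|lebesgue. ?h x)"
      using eq[of UNIV] by (simp add: set_lebesgue_integral_def)
    also have "\<dots> = (LINT x:{a..b}|lebesgue. ?h x)"
      unfolding set_lebesgue_integral_def by (intro Bochner_Integration.integral_cong) (auto simp: indicator_def)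
    also have "\<dots> = (LBINT x:{a..b}. k x)" by (rule eq[symmetric]) simp
    also have "\<dots> = 0"
    proof (cases "a \<le> b")
      case False
      then show ?thesis by (simp add: set_lebesgue_integral_def)
    qed (rule Icc)
    finally show ?thesis .
  qed
  have sk: "set_integrable lborel A k" if "A \<in> sets borel" for A
    unfolding set_integrable_def using that by (intro integrable_mult_indicator ki) auto
  \<comment> \<open>Sets with vanishing integral include the closed intervals and are closed under
    complements and countable disjoint unions, so all Borel sets are among them, and this forces k =
    0 almost everywhere.\<close>
  have "(LBINT x:A. k x) = 0" if "A \<in> sets borel" for A
    using that
  proof (induction rule: borel_set_induct)
    case (compl A)
    have "(LBINT x:UNIV. k x) = (LBINT x:A. k x) + (LBINT x:-A. k x)"
      using compl.hyps by (subst set_integral_Un[symmetric]) (auto intro!: sk simp: Compl_partition)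
    then show ?case using tot compl by (simp add: set_lebesgue_integral_def)
  next
    case (union A)
    have "(LBINT x:(\<Union>i. A i). k x) = (\<Sum>i. LBINT x:A i. k x)"
      using union by (intro lebesgue_integral_countable_add sk) (auto simp: disjoint_family_on_def)
    then show ?case using union by simp
  qed (use Icc in \<open>auto simp: set_lebesgue_integral_def\<close>)
  then have "AE x in lborel. k x = 0" by (intro density_unique_real[OF ki]) (auto simp: set_lebesgue_integral_def)
  then have "AE x in lebesgue. k x = 0" by (rule AE_completion)
  with ae show ?thesis by eventually_elim (auto simp: indicator_def)
qed

text \<open>By the fundamental theorem both candidates integrate to f d - f c over (c, d] whenever
  [c, d] lies in U. Their difference therefore vanishes almost everywhere on each of countably many
  compact intervals exhausting U.\<close>

lemma weak_derivative_unique: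
  assumes U: "U = einterval \<alpha> \<beta>" and "weak_derivative_on U f g" "weak_derivative_on U f h"
    and f: "continuous_on U f"
  shows "AE x in lebesgue. x \<in> U \<longrightarrow> g x = h x"
proof (cases "\<alpha> < \<beta>")
  case True
  have "\<exists>u l. einterval \<alpha> \<beta> = (\<Union>i::nat. {l i .. u i})"
    by (rule einterval_Icc_approximation[OF True]) (rule exI, rule exI, assumption)
  then obtain u l where ul: "einterval \<alpha> \<beta> = (\<Union>i::nat. {l i .. u i})" by blast
  have loc: "set_integrable lebesgue {c..d} g" "set_integrable lebesgue {c..d} h" if "{c..d} \<subseteq> U" for c d
    using that assms by (auto simp: weak_derivative_on_def locally_integrable_on_def)
  have "AE x in lebesgue. x \<in> {l i..u i} \<longrightarrow> g x - h x = 0" for i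
  proof (rule AE_zero_if_integrals_Ioc_zero)
    have sub: "{l i..u i} \<subseteq> U" using ul U by auto
    then show "set_integrable lebesgue {l i..u i} (\<lambda>x. g x - h x)"
      by (intro set_integral_diff loc)
    fix c d assume cd: "l i \<le> c" "c \<le> d" "d \<le> u i"
    then have "{c..d} \<subseteq> U" using sub by auto
    note loc' = loc[OF this]
    have "set_integrable lebesgue {c<..d} g" "set_integrable lebesgue {c<..d} h"
      by (rule set_integrable_subset[OF loc'(1)], auto) (rule set_integrable_subset[OF loc'(2)], auto)
    then have "(LINT x:{c<..d}|lebesgue. g x - h x) = (LINT x:{c<..d}|lebesgue. g x) - (LINT x:{c<..d}|lebesgue. h x)"
      by (rule set_integral_diff)
    also have "\<dots> = 0"
      using weak_derivative_FTC[OF _ cd(2) \<open>{c..d} \<subseteq> U\<close> _ f] assms by (simp add: open_einterval)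
    finally show "(LINT x:{c<..d}|lebesgue. g x - h x) = 0" .
  qed
  then have "AE x in lebesgue. \<forall>i. x \<in> {l i..u i} \<longrightarrow> g x - h x = 0"
    by (intro iffD2[OF AE_all_countable] allI)
  then show ?thesis
    by eventually_elim (auto simp: U ul)
next
  case False
  then have "U = {}" unfolding U einterval_def by (auto dest: less_trans)
  then show ?thesis by simp
qed

text \<open>\<open>sobolev_W11\<close> promises some integrable weak derivative h, which may differ
  from the given g. Uniqueness transfers integrability from h to g, and Borel measurability of g
  leads from \<open>lebesgue\<close> to \<open>lborel\<close>.\<close>

lemma weak_derivative_integrable:
  assumes U: "U = einterval \<alpha> \<beta>" and "f \<in> sobolev_W11 U" "weak_derivative_on U f g"
    and f: "continuous_on U f" and g[measurable]: "g \<in> borel_measurable borel"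
  shows "set_integrable lborel U g"
proof -
  have [measurable]: "U \<in> sets borel" unfolding U by simp
  obtain h where h: "set_integrable lebesgue U h" and wh: "weak_derivative_on U f h"
    using assms by (auto simp: sobolev_W11_def)
  have "(\<lambda>x. indicator U x *\<^sub>R g x) \<in> borel_measurable lborel" by simp
  note this measurable_completion[OF this]
  moreover have "AE x in lebesgue. x \<in> U \<longrightarrow> h x = g x"
    by (rule weak_derivative_unique[OF U wh _ f]) fact
  then have "AE x in lebesgue. indicator U x *\<^sub>R h x = indicator U x *\<^sub>R g x"
    by eventually_elim (auto simp: indicator_def)
  ultimately show ?thesis
    using h unfolding set_integrable_def
    by (subst integrable_completion[symmetric]) (auto intro: integrable_cong_AE_imp)
qed

section \<open>The fundamental theorem up to the endpoints\<close>

lemma weak_derivative_FTC_einterval: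
  fixes f g :: "real \<Rightarrow> real" and a b \<alpha> \<beta> :: ereal
  assumes "U = einterval \<alpha> \<beta>" "\<alpha> \<le> a" "a < b" "b \<le> \<beta>"
    and wd: "weak_derivative_on U f g" and f: "continuous_on U f" and [measurable]: "g \<in> borel_measurable borel"
    and gi: "set_integrable lborel U g"
    and A: "\<And>u. (\<And>i. a < ereal (u i)) \<Longrightarrow> (\<And>i. ereal (u i) < b) \<Longrightarrow> (\<lambda>i. ereal (u i)) \<longlonglongrightarrow> a \<Longrightarrow> (\<lambda>i. f (u i)) \<longlonglongrightarrow> A"
    and B: "\<And>u. (\<And>i. a < ereal (u i)) \<Longrightarrow> (\<And>i. ereal (u i) < b) \<Longrightarrow> (\<lambda>i. ereal (u i)) \<longlonglongrightarrow> b \<Longrightarrow> (\<lambda>i. f (u i)) \<longlonglongrightarrow> B"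
  shows "(LBINT x:einterval a b. g x) = B - A"
proof -
  obtain u l where ul: "einterval a b = (\<Union>i. {l i .. u i})" "incseq u" "decseq l"
    "\<And>i. l i < u i" "\<And>i. a < ereal (l i)" "\<And>i. ereal (u i) < b"
    "(\<lambda>i. ereal (l i)) \<longlonglongrightarrow> a" "(\<lambda>i. ereal (u i)) \<longlonglongrightarrow> b"
    by (rule einterval_Icc_approximation[OF \<open>a < b\<close>]) (rule that)
  have lu: "a < ereal (u i)" "ereal (l i) < b" for i
    using ul(4)[of i] ul(5)[of i] ul(6)[of i] less_trans[of a "ereal (l i)" "ereal (u i)"]
      less_trans[of "ereal (l i)" "ereal (u i)" b] by auto
  have sub: "einterval a b \<subseteq> U"
    using assms by (auto simp: einterval_def intro: le_less_trans less_le_trans)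
  have gab: "set_integrable lborel (einterval a b) g"
    by (rule set_integrable_subset[OF gi _ sub]) simp
  \<comment> \<open>The compact intervals stay inside U. The endpoint values \<open>A\<close> and
    \<open>B\<close> enter only in the limit over i, so finite and infinite endpoints are handled
    alike.\<close>
  have "(LBINT x=l i..u i. g x) = f (u i) - f (l i)" for i
  proof -
    have "(LBINT x=l i..u i. g x) = (LBINT x:{l i<..u i}. g x)"
      using ul(4)[of i] by (simp add: interval_integral_Ioc)
    also have "\<dots> = (LINT x:{l i<..u i}|lebesgue. g x)"
      unfolding set_lebesgue_integral_def by (intro integral_completion[symmetric]) simp
    also have "\<dots> = f (u i) - f (l i)"
    proof (rule weak_derivative_FTC[OF _ _ _ wd f])
      show "open U" unfolding assms(1) by (rule open_einterval)
      show "l i \<le> u i" by (rule less_imp_le) (rule ul)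
      show "{l i..u i} \<subseteq> U" using ul(1) sub by blast
    qed
    finally show ?thesis .
  qed
  moreover have "(\<lambda>i. LBINT x=l i..u i. g x) \<longlonglongrightarrow> (LBINT x=a..b. g x)"
    by (rule interval_integral_Icc_approx_integrable[OF \<open>a < b\<close> ul gab])
  moreover have "(\<lambda>i. f (u i) - f (l i)) \<longlonglongrightarrow> B - A"
    by (intro tendsto_diff A B ul lu)
  ultimately have "(LBINT x=a..b. g x) = B - A"
    using LIMSEQ_unique by auto
  then show ?thesis
    using \<open>a < b\<close> by (simp add: interval_lebesgue_integral_def less_imp_le)
qed

text \<open>The endpoints 0 and \<open>Lmax\<close> lie outside the open interval of the weak
  derivative. Continuity on the closed range supplies the limits at finite endpoints, and the limit
  at infinity supplies \<open>qinf\<close>.\<close>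

lemma sobolev_path_FTC:
  fixes q g :: "real \<Rightarrow> real" and Lmax :: ereal
  assumes "0 \<le> Lmax" and lim: "(q \<longlongrightarrow> qinf) at_top"
    and W: "q \<in> sobolev_W11 (einterval 0 Lmax)"
    and q: "continuous_on {l. 0 \<le> l \<and> ereal l \<le> Lmax} q"
    and wd: "weak_derivative_on (einterval 0 Lmax) q g"
    and g: "g \<in> borel_measurable borel"
  shows "set_integrable lborel (einterval 0 Lmax) g"
    and "\<And>a b. 0 \<le> a \<Longrightarrow> a < b \<Longrightarrow> ereal b \<le> Lmax \<Longrightarrow> (LBINT l:{a<..<b}. g l) = q b - q a"
    and "(LBINT l:einterval 0 Lmax. g l) = (if Lmax = \<infinity> then qinf else q (real_of_ereal Lmax)) - q 0"
proof -
  have qU: "continuous_on (einterval 0 Lmax) q"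
    by (rule continuous_on_subset[OF q]) (auto simp: einterval_def)
  show gi: "set_integrable lborel (einterval 0 Lmax) g"
    by (rule weak_derivative_integrable[OF refl W wd qU g])
  \<comment> \<open>The bounds b and c confine the sequence to the range where q is continuous; the
    claim serves left and right endpoints alike.\<close>
  have conv: "(\<lambda>i. q (u i)) \<longlonglongrightarrow> q a"
    if "0 \<le> a" "ereal a \<le> Lmax" "\<And>i. ereal (u i) < b" "b \<le> Lmax" "\<And>i. c < ereal (u i)" "0 \<le> c"
      "(\<lambda>i. ereal (u i)) \<longlonglongrightarrow> ereal a" for u a b c
  proof (rule continuous_on_tendsto_compose[OF q])
    show "u \<longlonglongrightarrow> a" using that by simp
    have "0 \<le> u i \<and> ereal (u i) \<le> Lmax" for i
      using that(3)[of i] that(4) that(5)[of i] that(6) le_less_trans[of 0 c "ereal (u i)"]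
        less_le_trans[of "ereal (u i)" b Lmax] by (simp add: less_imp_le)
    then show "\<forall>\<^sub>F i in sequentially. u i \<in> {l. 0 \<le> l \<and> ereal l \<le> Lmax}" by simp
  qed (use that in auto)
  show FTC: "(LBINT l:{a<..<b}. g l) = q b - q a" if ab: "0 \<le> a" "a < b" "ereal b \<le> Lmax" for a b
  proof -
    have aL: "ereal a \<le> Lmax" using ab less_le_trans[of "ereal a" "ereal b" Lmax] by (simp add: less_imp_le)
    have "(LBINT l:einterval (ereal a) (ereal b). g l) = q b - q a"
    proof (rule weak_derivative_FTC_einterval[OF refl _ _ _ wd qU g gi])
      fix u :: "nat \<Rightarrow> real" assume u: "\<And>i. ereal a < ereal (u i)" "\<And>i. ereal (u i) < ereal b"
      show "(\<lambda>i. q (u i)) \<longlonglongrightarrow> q a" if "(\<lambda>i. ereal (u i)) \<longlonglongrightarrow> ereal a"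
        by (rule conv[OF _ aL u(2) _ u(1) _ that]) (use ab in auto)
      show "(\<lambda>i. q (u i)) \<longlonglongrightarrow> q b" if "(\<lambda>i. ereal (u i)) \<longlonglongrightarrow> ereal b"
        by (rule conv[OF _ _ u(2) _ u(1) _ that]) (use ab in auto)
    qed (use ab in auto)
    then show ?thesis by simp
  qed
  show "(LBINT l:einterval 0 Lmax. g l) = (if Lmax = \<infinity> then qinf else q (real_of_ereal Lmax)) - q 0"
  proof (cases Lmax)
    case (real m)
    show ?thesis
    \<comment> \<open>For m = 0 the interval is empty and both sides are 0; the increment formula
      asks for 0 < m.\<close>
    proof (cases "m = 0")
      case True
      then show ?thesis using real by (simp add: einterval_def set_lebesgue_integral_def zero_ereal_def)
    next
      case False
      then show ?thesis
        using real assms(1) FTC[of 0 m] by (simp add: zero_ereal_def)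
    qed
  next
    case PInf
    have "(LBINT l:einterval 0 Lmax. g l) = qinf - q 0"
    proof (rule weak_derivative_FTC_einterval[OF refl _ _ _ wd qU g gi])
      fix u :: "nat \<Rightarrow> real" assume u: "\<And>i. 0 < ereal (u i)" "\<And>i. ereal (u i) < Lmax"
      show "(\<lambda>i. q (u i)) \<longlonglongrightarrow> q 0" if "(\<lambda>i. ereal (u i)) \<longlonglongrightarrow> 0"
        by (rule conv[OF _ _ u(2) _ u(1)]) (use PInf that in \<open>auto simp: zero_ereal_def\<close>)
      show "(\<lambda>i. q (u i)) \<longlonglongrightarrow> qinf" if "(\<lambda>i. ereal (u i)) \<longlonglongrightarrow> Lmax"
        using that PInf by (intro filterlim_compose[OF lim]) (simp add: tendsto_PInfty_eq_at_top)
    qed (use PInf in auto)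
    then show ?thesis using PInf by simp
  qed (use assms in auto)
qed

subsection \<open>Integrals weighted by the law of the level\<close>

text \<open>In the theorem \<mu> is the law of \<open>L\<close>. Working with the law separates the
  level x from the path, which can then be held fixed.\<close>

locale level_law = prob_space \<mu> for \<mu> :: "real measure" +
  fixes Lmax :: ereal
  assumes sets_law[measurable_cong]: "sets \<mu> = sets borel"
    and Lmax_nonneg: "0 \<le> Lmax"
    and pos: "0 \<le> l \<Longrightarrow> ereal l < Lmax \<Longrightarrow> measure \<mu> {l..} > 0"
begin

definition surv :: "real \<Rightarrow> real" where "surv l = measure \<mu> {l..}"

definition weight :: "real \<Rightarrow> real \<Rightarrow> real" where
  "weight x l = (if 0 \<le> l \<and> l \<le> x then 1 / surv l else 0)"

definition knot :: "nat \<Rightarrow> nat \<Rightarrow> real" where "knot n i = real i / real (Suc n)"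

text \<open>Left-endpoint sums for the integral of \<open>weight x\<close> against dq. The mesh is 1
  / (n + 1) and the (n + 1)^2 cells reach up to n + 1, so the grid refines and exhausts the
  half-line at once; a cell that crosses \<open>Lmax\<close> is cut there.\<close>

definition RS_sum :: "nat \<Rightarrow> real \<Rightarrow> (real \<Rightarrow> real) \<Rightarrow> real" where
  "RS_sum n x q = (\<Sum>i<(Suc n)\<^sup>2. if ereal (knot n i) < Lmax
     then weight x (knot n i) * (q (real_of_ereal (min (ereal (knot n (Suc i))) Lmax)) - q (knot n i)) else 0)"

text \<open>\<open>lim\<close> assigns a value to every q, convergent or not, so this is a function
  on the whole path space; \<open>RS_integral_eq\<close> identifies it with an integral for suitable
  q.\<close>

definition RS_integral :: "real \<Rightarrow> (real \<Rightarrow> real) \<Rightarrow> real" where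
  "RS_integral x q = lim (\<lambda>n. RS_sum n x q)"

lemma surv_antimono: "a \<le> b \<Longrightarrow> surv b \<le> surv a"
  unfolding surv_def by (intro finite_measure_mono) (auto simp: sets_law)

lemma surv_nonneg: "0 \<le> surv a"
  by (simp add: surv_def)

lemma surv_measurable[measurable]: "surv \<in> borel_measurable borel"
proof -
  have "(\<lambda>x. - surv x) \<in> borel_measurable borel"
    by (intro borel_measurable_mono) (auto simp: mono_def surv_antimono)
  then have "(\<lambda>x. - (- surv x)) \<in> borel_measurable borel" by (rule borel_measurable_uminus)
  then show ?thesis by simp
qed

lemma weight_measurable[measurable]: "(\<lambda>(x, l). weight x l) \<in> borel_measurable (borel \<Otimes>\<^sub>M borel)"
  unfolding weight_def by measurable

lemma weight_nonneg: "0 \<le> weight x l"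
  by (auto simp: weight_def surv_nonneg)

text \<open>Each sum involves finitely many coordinates of q, all at non-negative levels, so it is
  measurable for the product sigma-algebra; the limit inherits this.\<close>

lemma RS_integral_measurable:
  "(\<lambda>(x, q). RS_integral x q) \<in> borel_measurable (borel \<Otimes>\<^sub>M PiM {0..} (\<lambda>_. borel))"
proof -
  have c[measurable]: "(\<lambda>(x::real, q). q t) \<in> borel_measurable (borel \<Otimes>\<^sub>M PiM {0..} (\<lambda>_. borel))" if "0 \<le> t" for t :: real
    using that by (auto simp: case_prod_beta' intro!: measurable_compose[OF measurable_snd] measurable_component_singleton)
  have w[measurable]: "(\<lambda>(x::real, q). weight x t) \<in> borel_measurable (borel \<Otimes>\<^sub>M PiM {0..} (\<lambda>_. borel))" for t
    unfolding case_prod_beta' by (rule measurable_compose[OF measurable_fst]) (simp add: weight_def)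
  have "0 \<le> knot n i" "0 \<le> real_of_ereal (min (ereal (knot n i)) Lmax)" for n i
    using Lmax_nonneg by (auto simp: knot_def intro!: real_of_ereal_pos)
  then have "(\<lambda>(x, q). RS_sum n x q) \<in> borel_measurable (borel \<Otimes>\<^sub>M PiM {0..} (\<lambda>_. borel))" for n
    using c w unfolding RS_sum_def case_prod_beta' by (intro borel_measurable_sum measurable_If
      borel_measurable_times borel_measurable_diff) (auto simp: case_prod_beta')
  then show ?thesis
    unfolding RS_integral_def case_prod_beta' by (intro borel_measurable_lim_metric)
qed

section \<open>Left continuity and boundedness of the weight\<close>

lemma surv_tendsto_left:
  assumes "\<And>n. u n \<le> l" "u \<longlonglongrightarrow> l"
  shows "(\<lambda>n. surv (u n)) \<longlonglongrightarrow> surv l"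
proof -
  \<comment> \<open>The indicators converge because u n approaches l from below; from above the
    limit could lose the mass at l.\<close>
  have "(\<lambda>n. \<integral>x. indicator {u n..} x \<partial>\<mu>) \<longlonglongrightarrow> (\<integral>x. indicator {l..} x \<partial>\<mu> :: real)"
  proof (rule integral_dominated_convergence[where w="\<lambda>_. 1"])
    show "AE x in \<mu>. (\<lambda>n. indicator {u n..} x) \<longlonglongrightarrow> (indicator {l..} x :: real)"
    proof (rule AE_I2, rule tendsto_eventually)
      fix x :: real
      show "\<forall>\<^sub>F n in sequentially. indicator {u n..} x = (indicator {l..} x :: real)"
      proof (cases "l \<le> x")
        case True
        then show ?thesis using assms(1) order_trans[of "u _" l x] by (auto simp: indicator_def)
      next
        case False
        then have "\<forall>\<^sub>F n in sequentially. x < u n" using assms(2) by (intro order_tendstoD) auto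
        then show ?thesis by eventually_elim (use False in \<open>auto simp: indicator_def\<close>)
      qed
    qed
  qed (auto simp: indicator_def)
  then show ?thesis by (simp add: surv_def)
qed

text \<open>Approaching from the left respects the cut-off as well: if l <= x then u n <= x for all
  n, and if x < l then eventually x < u n.\<close>

lemma weight_tendsto_left:
  assumes "\<And>n. u n \<le> l" "u \<longlonglongrightarrow> l" "\<And>n. 0 \<le> u n" "surv l > 0"
  shows "(\<lambda>n. weight x (u n)) \<longlonglongrightarrow> weight x l"
proof (cases "l \<le> x")
  case True
  have "0 \<le> l" using assms(1,3) order_trans by blast
  have "(\<lambda>n. 1 / surv (u n)) \<longlonglongrightarrow> 1 / surv l"
    using assms by (intro tendsto_divide tendsto_const surv_tendsto_left) auto
  then show ?thesis
    using True assms \<open>0 \<le> l\<close> order_trans[OF assms(1) True] by (simp add: weight_def)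
next
  case False
  then have "\<forall>\<^sub>F n in sequentially. x < u n" using assms(2) by (intro order_tendstoD) auto
  then have "\<forall>\<^sub>F n in sequentially. weight x (u n) = weight x l"
    by eventually_elim (use False in \<open>auto simp: weight_def\<close>)
  then show ?thesis by (rule tendsto_eventually)
qed

text \<open>The levels at which the cut-off weight is bounded below \<open>Lmax\<close>. For \<open>Lmax = \<infinity>\<close> the second
  disjunct involves the junk value \<open>real_of_ereal \<infinity> = 0\<close>, but then the first one holds anyway.\<close>

definition regular_level :: "real \<Rightarrow> bool" where
  "regular_level x \<longleftrightarrow> ereal x < Lmax \<or> surv (real_of_ereal Lmax) > 0"

text \<open>A level that is not regular lies at or above a finite \<open>Lmax\<close> at which
  \<open>surv\<close> is 0, and such levels form a null set.\<close>

lemma AE_regular_level: "AE x in \<mu>. regular_level x"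
proof (cases "surv (real_of_ereal Lmax) > 0 \<or> Lmax = \<infinity>")
  case False
  then have "surv (real_of_ereal Lmax) = 0" using surv_nonneg[of "real_of_ereal Lmax"] by linarith
  then have "{real_of_ereal Lmax..} \<in> null_sets \<mu>"
    by (auto simp: null_sets_def surv_def emeasure_eq_measure sets_law)
  then have "AE x in \<mu>. x \<notin> {real_of_ereal Lmax..}" by (rule AE_not_in)
  then show ?thesis
    by eventually_elim (use False Lmax_nonneg in \<open>unfold regular_level_def, cases Lmax, auto\<close>)
qed (auto simp: regular_level_def)

text \<open>Below \<open>Lmax\<close> the factor 1 / surv is increasing. It bounds the weight by its
  value at the cut-off x if x < Lmax, and otherwise by its value at \<open>Lmax\<close>, where
  regularity makes \<open>surv\<close> positive.\<close>

lemma weight_bounded: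
  assumes "regular_level x"
  obtains C where "\<And>l. 0 \<le> l \<Longrightarrow> ereal l < Lmax \<Longrightarrow> weight x l \<le> C"
proof (cases "ereal x < Lmax")
  case True
  show ?thesis
  proof (rule that[of "1 / surv x"])
    fix l assume "0 \<le> l" "ereal l < Lmax"
    show "weight x l \<le> 1 / surv x"
    proof (cases "l \<le> x")
      case True
      then have "surv x > 0" using \<open>0 \<le> l\<close> \<open>ereal x < Lmax\<close> pos[of x] by (simp add: surv_def)
      then show ?thesis using surv_antimono[OF True] \<open>0 \<le> l\<close> True
        by (simp add: weight_def frac_le)
    qed (simp add: weight_def surv_nonneg)
  qed
next
  case False
  then obtain m where m: "Lmax = ereal m" using Lmax_nonneg by (cases Lmax) auto
  with assms False have s: "surv m > 0" unfolding regular_level_def by simp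
  show ?thesis
  proof (rule that[of "1 / surv m"])
    fix l assume "0 \<le> l" "ereal l < Lmax"
    then show "weight x l \<le> 1 / surv m"
      using s surv_antimono[of l m] m by (auto simp: weight_def frac_le)
  qed
qed

section \<open>Convergence of the left-endpoint sums\<close>

definition knot_index :: "nat \<Rightarrow> real \<Rightarrow> nat" where "knot_index n l = nat \<lfloor>l * real (Suc n)\<rfloor>"

lemma knot_index_iff:
  assumes "0 \<le> l"
  shows "l \<in> {knot n i..<knot n (Suc i)} \<longleftrightarrow> i = knot_index n l"
proof -
  have "l \<in> {knot n i..<knot n (Suc i)} \<longleftrightarrow> of_int (int i) \<le> l * real (Suc n) \<and> l * real (Suc n) < of_int (int i) + 1"
    by (auto simp: knot_def field_simps simp del: of_nat_Suc)
  also have "\<dots> \<longleftrightarrow> \<lfloor>l * real (Suc n)\<rfloor> = int i" by (rule floor_eq_iff[symmetric])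
  also have "\<dots> \<longleftrightarrow> i = knot_index n l"
    using assms by (auto simp: knot_index_def)
  finally show ?thesis .
qed

lemma knot_knot_index_tendsto:
  assumes "0 \<le> l"
  shows "(\<lambda>n. knot n (knot_index n l)) \<longlonglongrightarrow> l"
proof (rule tendsto_sandwich[of "\<lambda>n. l - 1 / real (Suc n)" _ _ "\<lambda>_. l"])
  have "l - 1 / real (Suc n) \<le> knot n (knot_index n l)" "knot n (knot_index n l) \<le> l" for n
  proof -
    let ?k = "knot_index n l"
    have "knot n ?k \<le> l" "l < knot n (Suc ?k)"
      using knot_index_iff[OF assms, of n ?k] by auto
    moreover have "knot n (Suc ?k) = knot n ?k + 1 / real (Suc n)"
      by (simp add: knot_def add_divide_distrib)
    ultimately show "l - 1 / real (Suc n) \<le> knot n ?k" "knot n ?k \<le> l" by linarith+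
  qed
  then show "\<forall>\<^sub>F n in sequentially. l - 1 / real (Suc n) \<le> knot n (knot_index n l)"
    "\<forall>\<^sub>F n in sequentially. knot n (knot_index n l) \<le> l" by auto
  have "(\<lambda>n. l - 1 / real (Suc n)) \<longlonglongrightarrow> l - 0"
    by (intro tendsto_diff tendsto_const LIMSEQ_Suc lim_1_over_n)
  then show "(\<lambda>n. l - 1 / real (Suc n)) \<longlonglongrightarrow> l" by simp
qed auto

text \<open>Increments of q are integrals of g over cells, so each sum integrates g against a step
  function that carries the weight of the left knot. The step functions tend to the weight by left
  continuity and obey the bound of \<open>weight_bounded\<close>, so dominated convergence
  applies.\<close>

lemma RS_integral_eq:
  assumes "regular_level x"
    and [measurable]: "g \<in> borel_measurable borel" and g: "set_integrable lborel (einterval 0 Lmax) g"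
    and FTC: "\<And>a b. 0 \<le> a \<Longrightarrow> a < b \<Longrightarrow> ereal b \<le> Lmax \<Longrightarrow> (LBINT l:{a<..<b}. g l) = q b - q a"
  shows "RS_integral x q = (LBINT l:einterval 0 Lmax. weight x l * g l)"
proof -
  define U where "U = einterval 0 Lmax"
  have [measurable]: "U \<in> sets borel" unfolding U_def by simp
  have g: "set_integrable lborel U g" using g unfolding U_def .
  obtain C where C: "\<And>l. 0 \<le> l \<Longrightarrow> ereal l < Lmax \<Longrightarrow> weight x l \<le> C"
    using weight_bounded[OF \<open>regular_level x\<close>] by blast
  have wx[measurable]: "weight x \<in> borel_measurable borel"
    unfolding weight_def[abs_def] by measurable
  define c where "c n i = (if ereal (knot n i) < Lmax then weight x (knot n i) else 0)" for n i
  define s where "s n l = (\<Sum>i<(Suc n)\<^sup>2. c n i * indicator {knot n i..<knot n (Suc i)} l)" for n l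
  have knot0: "0 \<le> knot n i" for n i by (simp add: knot_def)
  have knot_less: "knot n i < knot n (Suc i)" for n i by (simp add: knot_def divide_strict_right_mono)
  have gI: "set_integrable lborel A g" if "A \<in> sets borel" "A \<subseteq> U" for A
    using that by (intro set_integrable_subset[OF g]) auto
  have cell: "c n i * (LBINT l:{knot n i..<knot n (Suc i)} \<inter> U. g l) =
     (if ereal (knot n i) < Lmax
     then weight x (knot n i) * (q (real_of_ereal (min (ereal (knot n (Suc i))) Lmax)) - q (knot n i)) else 0)" for n i
  proof (cases "ereal (knot n i) < Lmax")
    case True
    define r where "r = real_of_ereal (min (ereal (knot n (Suc i))) Lmax)"
    have r: "ereal r = min (ereal (knot n (Suc i))) Lmax"
      unfolding r_def using True by (cases Lmax) (auto simp: min_def)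
    have "ereal (knot n i) < ereal r" unfolding r using True knot_less by simp
    then have kr: "knot n i < r" by simp
    have rL: "ereal r \<le> Lmax" unfolding r by simp
    \<comment> \<open>The two domains differ at most in the left knot, which belongs to U unless it
      is 0.\<close>
    have "(LBINT l:{knot n i..<knot n (Suc i)} \<inter> U. g l) = (LBINT l:{knot n i<..<r}. g l)"
    proof (rule set_integral_discrete_difference[where X="{knot n i}"])
      have "l \<in> {knot n i<..<r}" if "l \<in> {knot n i..<knot n (Suc i)} \<inter> U" "l \<noteq> knot n i" for l
      proof -
        have "ereal l < ereal r" unfolding r using that by (auto simp: U_def einterval_def)
        then show ?thesis using that by auto
      qed
      moreover have "l \<in> {knot n i..<knot n (Suc i)} \<inter> U" if "l \<in> {knot n i<..<r}" for l
      proof -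
        have "ereal l < ereal r" using that by simp
        then have "ereal l < ereal (knot n (Suc i))" "ereal l < Lmax" unfolding r by (simp_all only: min_less_iff_conj)
        then show ?thesis using that knot0[of n i] by (auto simp: U_def einterval_def)
      qed
      ultimately show "{knot n i..<knot n (Suc i)} \<inter> U - {knot n i<..<r} \<union>
          ({knot n i<..<r} - {knot n i..<knot n (Suc i)} \<inter> U) \<subseteq> {knot n i}" by blast
    qed auto
    also have "\<dots> = q r - q (knot n i)" by (rule FTC[OF knot0 kr rL])
    finally show ?thesis using True by (simp add: c_def r_def)
  qed (simp add: c_def)
  have sum: "RS_sum n x q = (LBINT l:U. s n l * g l)" for n
  proof -
    have "RS_sum n x q = (\<Sum>i<(Suc n)\<^sup>2. c n i * (LBINT l:{knot n i..<knot n (Suc i)} \<inter> U. g l))"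
      unfolding RS_sum_def cell ..
    also have "\<dots> = (\<Sum>i<(Suc n)\<^sup>2. \<integral>l. c n i * (indicator ({knot n i..<knot n (Suc i)} \<inter> U) l * g l) \<partial>lborel)"
      by (simp add: set_lebesgue_integral_def)
    also have "\<dots> = (\<integral>l. (\<Sum>i<(Suc n)\<^sup>2. c n i * (indicator ({knot n i..<knot n (Suc i)} \<inter> U) l * g l)) \<partial>lborel)"
      using gI[of "{knot n _..<knot n (Suc _)} \<inter> U"]
      by (intro Bochner_Integration.integral_sum[symmetric] integrable_mult_right) (auto simp: set_integrable_def)
    also have "\<dots> = (LBINT l:U. s n l * g l)"
      unfolding set_lebesgue_integral_def s_def
      by (intro Bochner_Integration.integral_cong)
        (simp_all only: real_scaleR_def sum_distrib_left sum_distrib_right indicator_inter_arith mult_ac)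
    finally show ?thesis .
  qed
  \<comment> \<open>The cells are disjoint, so only the one containing l contributes; beyond the
    grid the sum is 0.\<close>
  have step: "s n l = (if knot_index n l < (Suc n)\<^sup>2 then c n (knot_index n l) else 0)" if "0 \<le> l" for n l
  proof -
    have "s n l = (\<Sum>i<(Suc n)\<^sup>2. if knot_index n l = i then c n i else 0)"
      unfolding s_def using knot_index_iff[OF that, of n] by (intro sum.cong) (auto simp: indicator_def)
    then show ?thesis by (simp add: sum.delta)
  qed
  have ki: "knot n (knot_index n l) \<le> l" if "0 \<le> l" for n l
    using knot_index_iff[OF that, of n "knot_index n l"] by simp
  have cU: "c n (knot_index n l) = weight x (knot n (knot_index n l))" if "l \<in> U" for n l
  proof -
    have "ereal (knot n (knot_index n l)) < Lmax"
      using ki[of l n] that le_less_trans[of "ereal (knot n (knot_index n l))" "ereal l" Lmax]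
      by (auto simp: U_def einterval_def)
    then show ?thesis by (simp add: c_def)
  qed
  have s_bound: "\<bar>s n l\<bar> \<le> C" if "l \<in> U" for n l
  proof -
    have l: "0 \<le> l" "ereal l < Lmax" using that by (auto simp: U_def einterval_def)
    \<comment> \<open>Non-negativity of C covers the levels beyond the grid, where
      \<open>s n l\<close> is 0.\<close>
    have "0 \<le> C" using C[OF l] weight_nonneg[of x l] by linarith
    moreover have "ereal (knot n (knot_index n l)) < Lmax"
      using ki[OF l(1), of n] l(2) le_less_trans[of "ereal (knot n (knot_index n l))" "ereal l" Lmax] by simp
    ultimately show ?thesis
      using C[OF knot0[of n "knot_index n l"]] weight_nonneg by (simp add: step[OF l(1)] cU[OF that])
  qed
  have s_lim: "(\<lambda>n. s n l) \<longlonglongrightarrow> weight x l" if "l \<in> U" for l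
  proof -
    have l: "0 \<le> l" "ereal l < Lmax" using that by (auto simp: U_def einterval_def)
    have "(\<lambda>n. weight x (knot n (knot_index n l))) \<longlonglongrightarrow> weight x l"
      using l pos[of l] by (intro weight_tendsto_left ki knot0 knot_knot_index_tendsto) (auto simp: surv_def)
    moreover have "\<forall>\<^sub>F n in sequentially. weight x (knot n (knot_index n l)) = s n l"
    proof -
      \<comment> \<open>Once n is at least l, the grid up to n + 1 contains l.\<close>
      have "knot_index n l < (Suc n)\<^sup>2" if "n \<ge> nat \<lceil>l\<rceil>" for n
      proof -
        have "l < real (Suc n)" using that by linarith
        then have "l * real (Suc n) < real (Suc n) * real (Suc n)" by (intro mult_strict_right_mono) auto
        then have "l * real (Suc n) < of_int (int ((Suc n)\<^sup>2))" by (simp only: of_int_of_nat_eq of_nat_mult of_int_mult power2_eq_square)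
        then have "\<lfloor>l * real (Suc n)\<rfloor> < int ((Suc n)\<^sup>2)" by (simp only: floor_less_iff)
        then show ?thesis using l(1) by (simp add: knot_index_def nat_less_iff)
      qed
      then show ?thesis
        unfolding eventually_sequentially using step[OF l(1)] cU[OF that]
        by (intro exI[of _ "nat \<lceil>l\<rceil>"]) auto
    qed
    ultimately show ?thesis by (rule Lim_transform_eventually)
  qed
  have "(\<lambda>n. LBINT l:U. s n l * g l) \<longlonglongrightarrow> (LBINT l:U. weight x l * g l)"
    unfolding set_lebesgue_integral_def
  proof (rule integral_dominated_convergence[where w="\<lambda>l. C * norm (indicator U l *\<^sub>R g l)"])
    show "integrable lborel (\<lambda>l. C * norm (indicator U l *\<^sub>R g l))"
      using g unfolding set_integrable_def by (intro integrable_mult_right integrable_norm)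
    show "(\<lambda>l. indicator U l *\<^sub>R (s n l * g l)) \<in> borel_measurable lborel" for n
      unfolding s_def by measurable
    show "AE l in lborel. (\<lambda>n. indicator U l *\<^sub>R (s n l * g l)) \<longlonglongrightarrow> indicator U l *\<^sub>R (weight x l * g l)"
    proof (rule AE_I2)
      fix l
      show "(\<lambda>n. indicator U l *\<^sub>R (s n l * g l)) \<longlonglongrightarrow> indicator U l *\<^sub>R (weight x l * g l)"
        by (cases "l \<in> U") (auto intro!: tendsto_mult tendsto_const s_lim)
    qed
    show "AE l in lborel. norm (indicator U l *\<^sub>R (s n l * g l)) \<le> C * norm (indicator U l *\<^sub>R g l)" for n
      using s_bound by (auto simp: indicator_def abs_mult intro!: mult_right_mono)
  qed measurable
  then show ?thesis
    unfolding RS_integral_def sum U_def by (rule limI)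
qed

section \<open>Averaging over the law of the level\<close>

context
  fixes g :: "real \<Rightarrow> real"
  assumes g[measurable]: "g \<in> borel_measurable borel"
begin

text \<open>Tonelli: at each level l in the open interval, the mean of \<open>weight x l\<close>
  over x is surv l / surv l = 1, with a positive denominator by \<open>pos\<close>. Both sides live
  in [0, oo], so the case of infinite mass is included.\<close>

lemma nn_integral_weight:
  "(\<integral>\<^sup>+x. \<integral>\<^sup>+l. ennreal (norm (indicator (einterval 0 Lmax) l *\<^sub>R (weight x l * g l))) \<partial>lborel \<partial>\<mu>) =
    (\<integral>\<^sup>+l\<in>einterval 0 Lmax. ennreal \<bar>g l\<bar> \<partial>lborel)"
proof -
  interpret pair_sigma_finite \<mu> lborel ..
  have "(\<integral>\<^sup>+x. \<integral>\<^sup>+l. ennreal (norm (indicator (einterval 0 Lmax) l *\<^sub>R (weight x l * g l))) \<partial>lborel \<partial>\<mu>) =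
      (\<integral>\<^sup>+l. \<integral>\<^sup>+x. ennreal (norm (indicator (einterval 0 Lmax) l *\<^sub>R (weight x l * g l))) \<partial>\<mu> \<partial>lborel)"
    by (rule Fubini'[symmetric]) measurable
  also have "\<dots> = (\<integral>\<^sup>+l\<in>einterval 0 Lmax. ennreal \<bar>g l\<bar> \<partial>lborel)"
  proof (rule nn_integral_cong)
    fix l :: real
    show "(\<integral>\<^sup>+x. ennreal (norm (indicator (einterval 0 Lmax) l *\<^sub>R (weight x l * g l))) \<partial>\<mu>) =
        ennreal \<bar>g l\<bar> * indicator (einterval 0 Lmax) l"
    proof (cases "l \<in> einterval 0 Lmax")
      case True
      then have l: "0 \<le> l" "surv l > 0" using pos[of l] by (auto simp: einterval_def surv_def)
      have "(\<integral>\<^sup>+x. ennreal (norm (indicator (einterval 0 Lmax) l *\<^sub>R (weight x l * g l))) \<partial>\<mu>) =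
          (\<integral>\<^sup>+x. ennreal (\<bar>g l\<bar> / surv l) * indicator {l..} x \<partial>\<mu>)"
        using True l by (intro nn_integral_cong) (auto simp: weight_def indicator_def abs_mult)
      also have "\<dots> = ennreal (\<bar>g l\<bar> / surv l) * ennreal (surv l)"
        by (simp add: nn_integral_cmult emeasure_eq_measure surv_def sets_law)
      also have "\<dots> = ennreal \<bar>g l\<bar>"
        using l by (simp add: ennreal_mult[symmetric])
      finally show ?thesis using True by simp
    qed simp
  qed
  finally show ?thesis .
qed

lemma nn_integral_weighted_integral_le:
  "(\<integral>\<^sup>+x. ennreal (norm (LBINT l:einterval 0 Lmax. weight x l * g l)) \<partial>\<mu>) \<le>
    (\<integral>\<^sup>+l\<in>einterval 0 Lmax. ennreal \<bar>g l\<bar> \<partial>lborel)"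
  unfolding nn_integral_weight[symmetric] set_lebesgue_integral_def
proof (rule nn_integral_mono)
  fix x
  let ?H = "\<lambda>l. indicator (einterval 0 Lmax) l *\<^sub>R (weight x l * g l)"
  show "ennreal (norm (\<integral>l. ?H l \<partial>lborel)) \<le> (\<integral>\<^sup>+l. ennreal (norm (?H l)) \<partial>lborel)"
  \<comment> \<open>If the integrand is not integrable, its integral is 0 by convention and the
    bound is trivial.\<close>
  proof (cases "integrable lborel ?H")
    case True
    then show ?thesis by (rule integral_norm_bound_ennreal)
  qed (simp add: not_integrable_integral_eq)
qed

text \<open>The same cancellation as in \<open>nn_integral_weight\<close>, now with signs; that
  lemma also bounds the absolute integral, which licenses Fubini.\<close>

lemma integral_weighted_integral:
  assumes gi: "set_integrable lborel (einterval 0 Lmax) g"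
  shows "(\<integral>x. (LBINT l:einterval 0 Lmax. weight x l * g l) \<partial>\<mu>) = (LBINT l:einterval 0 Lmax. g l)"
proof -
  interpret pair_sigma_finite \<mu> lborel ..
  let ?H = "\<lambda>x l. indicator (einterval 0 Lmax) l *\<^sub>R (weight x l * g l)"
  have "(\<integral>\<^sup>+l\<in>einterval 0 Lmax. ennreal \<bar>g l\<bar> \<partial>lborel) < \<infinity>"
    using gi unfolding set_integrable_def
    by (auto simp: integrable_iff_bounded indicator_mult_ennreal abs_mult mult.commute ennreal_mult' ennreal_indicator)
  then have "integrable (\<mu> \<Otimes>\<^sub>M lborel) (case_prod ?H)"
    unfolding nn_integral_weight[symmetric]
    by (intro integrableI_bounded) (auto simp: lborel.nn_integral_fst[symmetric] case_prod_beta')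
  from Fubini_integral[OF this] have "(\<integral>x. (LBINT l:einterval 0 Lmax. weight x l * g l) \<partial>\<mu>) =
      (\<integral>l. \<integral>x. ?H x l \<partial>\<mu> \<partial>lborel)"
    by (simp add: set_lebesgue_integral_def)
  also have "\<dots> = (LBINT l:einterval 0 Lmax. g l)"
    unfolding set_lebesgue_integral_def
  proof (rule Bochner_Integration.integral_cong[OF refl])
    fix l :: real
    show "(\<integral>x. ?H x l \<partial>\<mu>) = indicator (einterval 0 Lmax) l *\<^sub>R g l"
    proof (cases "l \<in> einterval 0 Lmax")
      case True
      then have l: "0 \<le> l" "surv l > 0" using pos[of l] by (auto simp: einterval_def surv_def)
      have "(\<integral>x. ?H x l \<partial>\<mu>) = (\<integral>x. g l / surv l * indicator {l..} x \<partial>\<mu>)"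
        using True l by (intro Bochner_Integration.integral_cong) (auto simp: weight_def indicator_def)
      also have "\<dots> = g l"
        using l by (simp add: surv_def sets_law)
      finally show ?thesis using True by simp
    qed simp
  qed
  finally show ?thesis .
qed

end

end

subsection \<open>Independence and the estimator\<close>

text \<open>Under the product law Fubini makes x + z integrable in x for almost every z. One such z
  is enough: subtracting the constant z leaves X.\<close>

lemma (in prob_space) integrable_summand_if_indep:
  fixes X Z :: "'a \<Rightarrow> real"
  assumes ind: "indep_var borel X borel Z" and int: "integrable M (\<lambda>\<omega>. X \<omega> + Z \<omega>)"
  shows "integrable M X"
proof -
  have [measurable]: "X \<in> borel_measurable M" "Z \<in> borel_measurable M"
    using indep_var_rv1[OF ind] indep_var_rv2[OF ind] by auto
  interpret X: prob_space "distr M borel X" by (rule prob_space_distr) simp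
  interpret Z: prob_space "distr M borel Z" by (rule prob_space_distr) simp
  interpret pair_sigma_finite "distr M borel X" "distr M borel Z" ..
  have "distr M borel X \<Otimes>\<^sub>M distr M borel Z = distr M (borel \<Otimes>\<^sub>M borel) (\<lambda>\<omega>. (X \<omega>, Z \<omega>))"
    using ind by (simp add: indep_var_distribution_eq)
  then have "integrable (distr M borel X \<Otimes>\<^sub>M distr M borel Z) (\<lambda>(x, z). x + z)"
    using int by (simp add: integrable_distr_eq case_prod_beta')
  then have "AE z in distr M borel Z. integrable (distr M borel X) (\<lambda>x. x + z)"
    by (rule AE_integrable_snd)
  then obtain z where "integrable (distr M borel X) (\<lambda>x. x + z)"
    using eventually_happens[of _ "ae_filter (distr M borel Z)"] Z.ae_filter_bot by auto
  then have "integrable (distr M borel X) (\<lambda>x. (x + z) - z)"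
    by (intro Bochner_Integration.integrable_diff) auto
  then show ?thesis by (simp add: integrable_distr_eq)
qed

text \<open>\<^const>\<open>prob_space.indep_var\<close> requires both variables to take values in the same type.\<close>

lemma (in prob_space) distr_pair_if_indep_set:
  assumes [measurable]: "X \<in> M \<rightarrow>\<^sub>M A" "Y \<in> M \<rightarrow>\<^sub>M B"
    and ind: "indep_set (sets (vimage_algebra (space M) X A)) (sets (vimage_algebra (space M) Y B))"
  shows "distr M A X \<Otimes>\<^sub>M distr M B Y = distr M (A \<Otimes>\<^sub>M B) (\<lambda>\<omega>. (X \<omega>, Y \<omega>))"
proof (rule pair_measure_eqI)
  interpret X: prob_space "distr M A X" by (rule prob_space_distr) simp
  interpret Y: prob_space "distr M B Y" by (rule prob_space_distr) simp
  show "sigma_finite_measure (distr M A X)" "sigma_finite_measure (distr M B Y)" ..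
  show "sets (distr M A X \<Otimes>\<^sub>M distr M B Y) = sets (distr M (A \<Otimes>\<^sub>M B) (\<lambda>\<omega>. (X \<omega>, Y \<omega>)))"
    by (simp cong: sets_pair_measure_cong)
  fix a b assume "a \<in> sets (distr M A X)" "b \<in> sets (distr M B Y)"
  then have [measurable]: "a \<in> sets A" "b \<in> sets B" by simp_all
  have "prob ((X -` a \<inter> space M) \<inter> (Y -` b \<inter> space M)) = prob (X -` a \<inter> space M) * prob (Y -` b \<inter> space M)"
    by (rule indep_setD[OF ind]) (auto intro: in_vimage_algebra)
  moreover have "(\<lambda>\<omega>. (X \<omega>, Y \<omega>)) -` (a \<times> b) \<inter> space M = (X -` a \<inter> space M) \<inter> (Y -` b \<inter> space M)"
    by auto
  ultimately show "emeasure (distr M A X) a * emeasure (distr M B Y) b =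
      emeasure (distr M (A \<Otimes>\<^sub>M B) (\<lambda>\<omega>. (X \<omega>, Y \<omega>))) (a \<times> b)"
    by (simp add: emeasure_distr emeasure_eq_measure ennreal_mult'')
qed

text \<open>The expectation of a non-integrable function is 0 by convention, so the identity is
  stated for an integrable estimator; a finite expected L1 norm of the derivative guarantees this.
  Continuity selects the representative of the Sobolev path for which the values at 0 and at a
  finite \<open>Lmax\<close> are meaningful.\<close>

theorem proposition2p1:
  fixes M :: "'a measure" and S :: "'s measure"
    and Q :: "real \<Rightarrow> 'a \<Rightarrow> real" and Qinf :: "'a \<Rightarrow> real"
    and dQ :: "'a \<Rightarrow> real \<Rightarrow> real"
    and L :: "'a \<Rightarrow> real" and Lmax :: ereal
    and N :: nat and \<xi> :: "nat \<Rightarrow> 's \<Rightarrow> 'a"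
  assumes "prob_space M"
    and "0 \<le> Lmax"
    and "\<forall>l\<ge>0. Q l \<in> borel_measurable M"
    and "Qinf \<in> borel_measurable M"
    and "AE \<omega> in M. ((\<lambda>l. Q l \<omega>) \<longlongrightarrow> Qinf \<omega>) at_top"
    and "AE \<omega> in M. (\<lambda>l. Q l \<omega>) \<in> sobolev_W11 (einterval 0 Lmax)"
    and "AE \<omega> in M. continuous_on {l. 0 \<le> l \<and> ereal l \<le> Lmax} (\<lambda>l. Q l \<omega>)"
    and "(\<lambda>(\<omega>, l). dQ \<omega> l) \<in> borel_measurable (M \<Otimes>\<^sub>M lborel)"
    and "AE \<omega> in M. weak_derivative_on (einterval 0 Lmax) (\<lambda>l. Q l \<omega>) (dQ \<omega>)"
    and "integrable M L"
    and "AE \<omega> in M. 0 \<le> L \<omega>"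
    and "prob_space.indep_set M (sets (vimage_algebra (space M) L borel)) (process_events M Q)"
    and "\<forall>l. 0 \<le> l \<and> ereal l < Lmax \<longrightarrow> measure M {\<omega> \<in> space M. L \<omega> \<ge> l} > 0"
    and "prob_space S"
    and "N \<ge> 1"
    and "prob_space.indep_vars S (\<lambda>_. M) \<xi> {1..N}"
    and "\<forall>k\<in>{1..N}. distr S M (\<xi> k) = M"
  shows "((\<integral>\<^sup>+\<omega>. (\<integral>\<^sup>+l\<in>einterval 0 Lmax. ennreal \<bar>dQ \<omega> l\<bar> \<partial>lborel) \<partial>M) < \<infinity>
            \<longrightarrow> integrable S (clmc_estimator M L dQ Lmax N \<xi>)) \<and>
         (integrable S (clmc_estimator M L dQ Lmax N \<xi>) \<longrightarrow>
            integrable M (\<lambda>\<omega>. value_at_level Q Qinf Lmax \<omega> - Q 0 \<omega>) \<and>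
            prob_space.expectation S (clmc_estimator M L dQ Lmax N \<xi>) =
            prob_space.expectation M (\<lambda>\<omega>. value_at_level Q Qinf Lmax \<omega> - Q 0 \<omega>))"
proof -
  interpret prob_space M by fact
  interpret S: prob_space S by fact
  have [measurable]: "L \<in> borel_measurable M" using assms(10) by auto
  have Qm[measurable]: "Q l \<in> borel_measurable M" if "0 \<le> l" for l using assms(3) that by blast
  have [measurable]: "Qinf \<in> borel_measurable M" by fact
  have dQm[measurable]: "(\<lambda>(\<omega>, l). dQ \<omega> l) \<in> borel_measurable (M \<Otimes>\<^sub>M borel)"
    using assms(8) by (simp cong: measurable_cong_sets)
  define \<mu> where "\<mu> = distr M borel L"
  have [measurable_cong]: "sets \<mu> = sets borel" by (simp add: \<mu>_def)
  have tail: "measure \<mu> {l..} = measure M {\<omega> \<in> space M. L \<omega> \<ge> l}" for l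
    unfolding \<mu>_def by (subst measure_distr) (auto intro!: arg_cong[where f="measure M"])
  interpret \<mu>: prob_space \<mu> unfolding \<mu>_def by (rule prob_space_distr) simp
  interpret law: level_law \<mu> Lmax
    by unfold_locales (use assms(2,13) tail \<open>sets \<mu> = sets borel\<close> in auto)
  define P where "P = PiM {0::real..} (\<lambda>_. borel :: real measure)"
  define path where "path \<omega> = (\<lambda>l\<in>{0..}. Q l \<omega>)" for \<omega>
  have path[measurable]: "path \<in> M \<rightarrow>\<^sub>M P"
    unfolding path_def[abs_def] P_def by (intro measurable_restrict) simp
  define \<nu> where "\<nu> = distr M P path"
  \<comment> \<open>Independence of \<open>L\<close> from the whole process enters here: the law of
    the pair is the product of the marginals.\<close>
  have joint: "\<mu> \<Otimes>\<^sub>M \<nu> = distr M (borel \<Otimes>\<^sub>M P) (\<lambda>\<omega>. (L \<omega>, path \<omega>))"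
    unfolding \<mu>_def \<nu>_def
    by (rule distr_pair_if_indep_set)
      (use assms(12) in \<open>auto simp: process_events_def P_def path_def[abs_def]\<close>)
  have [measurable_cong]: "sets \<nu> = sets P" by (simp add: \<nu>_def)
  interpret \<nu>: prob_space \<nu> unfolding \<nu>_def by (rule prob_space_distr) simp
  interpret J: pair_sigma_finite \<mu> \<nu> ..
  have R[measurable]: "(\<lambda>(x, q). law.RS_integral x q) \<in> borel_measurable (borel \<Otimes>\<^sub>M P)"
    unfolding P_def by (rule law.RS_integral_measurable)
  \<comment> \<open>Y is the contribution of one sample and D, defined next, its intended mean.
    Since Y involves \<open>dQ\<close>, it is not visibly a function of \<open>L\<close> and
    \<open>path\<close>.\<close>
  define Y where "Y \<omega> = (LBINT l:einterval 0 Lmax. law.weight (L \<omega>) l * dQ \<omega> l)" for \<omega>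
  define D where "D \<omega> = value_at_level Q Qinf Lmax \<omega> - Q 0 \<omega>" for \<omega>
  have est: "clmc_estimator M L dQ Lmax N \<xi> = (\<lambda>\<sigma>. (1 / real N) * (\<Sum>k=1..N. Y (\<xi> k \<sigma>)))"
  proof
    fix \<sigma>
    have "(LBINT l=0..Lmax. 1 / measure M {\<omega> \<in> space M. L \<omega> \<ge> l} * dQ \<omega> l * indicator {0..L \<omega>} l) = Y \<omega>" for \<omega>
      unfolding Y_def interval_lebesgue_integral_def set_lebesgue_integral_def using assms(2)
      by (auto simp: law.weight_def law.surv_def tail indicator_def intro!: Bochner_Integration.integral_cong)
    then show "clmc_estimator M L dQ Lmax N \<xi> \<sigma> = (1 / real N) * (\<Sum>k=1..N. Y (\<xi> k \<sigma>))"
      by (simp add: clmc_estimator_def)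
  qed
  have Ym[measurable]: "Y \<in> borel_measurable M"
    unfolding Y_def set_lebesgue_integral_def law.weight_def by measurable
  have Dm[measurable]: "D \<in> borel_measurable M"
    using assms(2) unfolding D_def value_at_level_def
    by (cases "Lmax = \<infinity>") (auto intro!: borel_measurable_diff Qm real_of_ereal_pos)
  \<comment> \<open>The quantifier over x stands inside the almost sure statement: the exceptional
    paths are the same for all x, so x may be integrated out or replaced by
    \<open>L \<omega>\<close>.\<close>
  have paths: "AE \<omega> in M. \<omega> \<in> space M \<and> dQ \<omega> \<in> borel_measurable borel \<and>
      set_integrable lborel (einterval 0 Lmax) (dQ \<omega>) \<and>
      (LBINT l:einterval 0 Lmax. dQ \<omega> l) = D \<omega> \<and>
      (\<forall>x. law.regular_level x \<longrightarrow> law.RS_integral x (path \<omega>) = (LBINT l:einterval 0 Lmax. law.weight x l * dQ \<omega> l))"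
    using assms(5,6,7,9) AE_space
  proof eventually_elim
    case (elim \<omega>)
    have [measurable]: "dQ \<omega> \<in> borel_measurable borel"
      using measurable_compose[OF measurable_Pair1'[OF \<open>\<omega> \<in> space M\<close>] dQm] by simp
    note F = sobolev_path_FTC[OF assms(2) elim(1-4) this]
    have "law.RS_integral x (path \<omega>) = (LBINT l:einterval 0 Lmax. law.weight x l * dQ \<omega> l)" if "law.regular_level x" for x
    proof (rule law.RS_integral_eq[OF that _ F(1)])
      show "(LBINT l:{a<..<b}. dQ \<omega> l) = path \<omega> b - path \<omega> a" if "0 \<le> a" "a < b" "ereal b \<le> Lmax" for a b
        using F(2)[OF that] that by (simp add: path_def)
    qed simp
    then show ?case
      using F elim by (auto simp: D_def value_at_level_def)
  qed
  \<comment> \<open>With the path frozen, the average over the level alone is D. Regular levels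
    carry full mass, so \<open>law.RS_integral\<close> may be exchanged for the weighted integral
    under the integral sign.\<close>
  have mean: "AE \<omega> in M. (\<integral>x. law.RS_integral x (path \<omega>) \<partial>\<mu>) = D \<omega>"
    using paths
  proof eventually_elim
    case (elim \<omega>)
    then have [measurable]: "dQ \<omega> \<in> borel_measurable borel" and [measurable]: "path \<omega> \<in> space P"
      using measurable_space[OF path] by auto
    have "(\<integral>x. law.RS_integral x (path \<omega>) \<partial>\<mu>) = (\<integral>x. (LBINT l:einterval 0 Lmax. law.weight x l * dQ \<omega> l) \<partial>\<mu>)"
    proof (rule integral_cong_AE)
      show "(\<lambda>x. law.RS_integral x (path \<omega>)) \<in> borel_measurable \<mu>"
        using measurable_compose[OF measurable_Pair2'[OF \<open>path \<omega> \<in> space P\<close>] R] by simp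
      show "(\<lambda>x. LBINT l:einterval 0 Lmax. law.weight x l * dQ \<omega> l) \<in> borel_measurable \<mu>"
        unfolding set_lebesgue_integral_def by measurable
      show "AE x in \<mu>. law.RS_integral x (path \<omega>) = (LBINT l:einterval 0 Lmax. law.weight x l * dQ \<omega> l)"
        using law.AE_regular_level by eventually_elim (use elim in blast)
    qed
    also have "\<dots> = D \<omega>"
      using elim by (subst law.integral_weighted_integral) auto
    finally show ?case .
  qed
  have bound: "AE \<omega> in M. (\<integral>\<^sup>+x. ennreal (norm (law.RS_integral x (path \<omega>))) \<partial>\<mu>) \<le>
      (\<integral>\<^sup>+l\<in>einterval 0 Lmax. ennreal \<bar>dQ \<omega> l\<bar> \<partial>lborel)"
    using paths
  proof eventually_elim
    case (elim \<omega>)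
    then have m: "dQ \<omega> \<in> borel_measurable borel" by blast
    have "(\<integral>\<^sup>+x. ennreal (norm (law.RS_integral x (path \<omega>))) \<partial>\<mu>) =
        (\<integral>\<^sup>+x. ennreal (norm (LBINT l:einterval 0 Lmax. law.weight x l * dQ \<omega> l)) \<partial>\<mu>)"
    proof (rule nn_integral_cong_AE)
      show "AE x in \<mu>. ennreal (norm (law.RS_integral x (path \<omega>))) =
          ennreal (norm (LBINT l:einterval 0 Lmax. law.weight x l * dQ \<omega> l))"
        using law.AE_regular_level by eventually_elim (use elim in auto)
    qed
    also have "\<dots> \<le> (\<integral>\<^sup>+l\<in>einterval 0 Lmax. ennreal \<bar>dQ \<omega> l\<bar> \<partial>lborel)"
      by (rule law.nn_integral_weighted_integral_le[OF m])
    finally show ?case .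
  qed
  have "AE \<omega> in M. law.regular_level (L \<omega>)"
    using law.AE_regular_level unfolding \<mu>_def by (rule AE_distrD[rotated]) simp
  with paths have YR: "AE \<omega> in M. Y \<omega> = law.RS_integral (L \<omega>) (path \<omega>)"
    by eventually_elim (auto simp: Y_def)
  have RM[measurable]: "(\<lambda>\<omega>. law.RS_integral (L \<omega>) (path \<omega>)) \<in> borel_measurable M"
    using measurable_compose[OF measurable_Pair[of L M borel path P] R] by simp
  \<comment> \<open>Y agrees almost surely with a measurable function of \<open>L\<close> and
    \<open>path\<close>, so its integrability and its mean can be read off on the product
    space.\<close>
  have Y_iff: "integrable M Y \<longleftrightarrow> integrable (\<mu> \<Otimes>\<^sub>M \<nu>) (\<lambda>(x, q). law.RS_integral x q)"
    unfolding joint integrable_cong_AE[OF Ym RM YR]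
    by (subst integrable_distr_eq) (auto simp: case_prod_beta')
  have Y_integral: "integral\<^sup>L M Y = integral\<^sup>L (\<mu> \<Otimes>\<^sub>M \<nu>) (\<lambda>(x, q). law.RS_integral x q)"
    unfolding joint integral_cong_AE[OF Ym RM YR]
    by (subst integral_distr) (auto simp: case_prod_beta')

  have \<xi>m[measurable]: "\<xi> k \<in> S \<rightarrow>\<^sub>M M" if "k \<in> {1..N}" for k
    using assms(16) that by (auto simp: S.indep_vars_def)
  have Y\<xi>: "integrable S (\<lambda>\<sigma>. Y (\<xi> k \<sigma>)) \<longleftrightarrow> integrable M Y"
    "integral\<^sup>L S (\<lambda>\<sigma>. Y (\<xi> k \<sigma>)) = integral\<^sup>L M Y" if "k \<in> {1..N}" for k
    using assms(17) that integrable_distr_eq[OF \<xi>m[OF that] Ym] integral_distr[OF \<xi>m[OF that] Ym] by auto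

  \<comment> \<open>Tonelli on the product of the laws, with the path integrated last, reduces the
    claim to \<open>bound\<close>.\<close>
  have part1: "integrable S (clmc_estimator M L dQ Lmax N \<xi>)"
    if fin: "(\<integral>\<^sup>+\<omega>. (\<integral>\<^sup>+l\<in>einterval 0 Lmax. ennreal \<bar>dQ \<omega> l\<bar> \<partial>lborel) \<partial>M) < \<infinity>"
  proof -
    have "(\<integral>\<^sup>+z. ennreal (norm (case z of (x, q) \<Rightarrow> law.RS_integral x q)) \<partial>(\<mu> \<Otimes>\<^sub>M \<nu>)) =
        (\<integral>\<^sup>+q. \<integral>\<^sup>+x. ennreal (norm (law.RS_integral x q)) \<partial>\<mu> \<partial>\<nu>)"
      by (subst J.nn_integral_snd[symmetric]) (auto simp: case_prod_beta')
    also have "\<dots> = (\<integral>\<^sup>+\<omega>. \<integral>\<^sup>+x. ennreal (norm (law.RS_integral x (path \<omega>))) \<partial>\<mu> \<partial>M)"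
      unfolding \<nu>_def by (subst nn_integral_distr) auto
    also have "\<dots> \<le> (\<integral>\<^sup>+\<omega>. (\<integral>\<^sup>+l\<in>einterval 0 Lmax. ennreal \<bar>dQ \<omega> l\<bar> \<partial>lborel) \<partial>M)"
      by (rule nn_integral_mono_AE[OF bound])
    finally have "integrable (\<mu> \<Otimes>\<^sub>M \<nu>) (\<lambda>(x, q). law.RS_integral x q)"
      using fin by (intro integrableI_bounded) (simp_all only: le_less_trans, measurable)
    then have "integrable M Y" by (simp add: Y_iff)
    then show ?thesis
      unfolding est by (intro integrable_mult_right Bochner_Integration.integrable_sum) (simp add: Y\<xi>)
  qed

  have part2: "integrable M D \<and> integral\<^sup>L S (clmc_estimator M L dQ Lmax N \<xi>) = integral\<^sup>L M D"
    if int: "integrable S (clmc_estimator M L dQ Lmax N \<xi>)"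
  proof -
    \<comment> \<open>The first sample is split off so that
      \<open>integrable_summand_if_indep\<close> applies; for N = 1 the other summand is the empty
      sum 0.\<close>
    have set: "{1..N} = insert 1 {2..N}" using assms(15) by auto
    have "integrable S (\<lambda>\<sigma>. real N * clmc_estimator M L dQ Lmax N \<xi> \<sigma>)"
      using int by (rule integrable_mult_right)
    then have add: "integrable S (\<lambda>\<sigma>. Y (\<xi> 1 \<sigma>) + (\<Sum>k=2..N. Y (\<xi> k \<sigma>)))"
      using assms(15) unfolding est set by simp
    have "S.indep_vars (\<lambda>_. borel) (\<lambda>k \<sigma>. Y (\<xi> k \<sigma>)) (insert 1 {2..N})"
      using S.indep_vars_compose2[OF assms(16), of "\<lambda>_. Y" "\<lambda>_. borel"] unfolding set by simp
    then have ind: "S.indep_var borel (\<lambda>\<sigma>. Y (\<xi> 1 \<sigma>)) borel (\<lambda>\<sigma>. \<Sum>k=2..N. Y (\<xi> k \<sigma>))"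
      by (intro S.indep_vars_sum) auto
    have "integrable S (\<lambda>\<sigma>. Y (\<xi> 1 \<sigma>))"
      by (rule S.integrable_summand_if_indep[OF ind add])
    then have Yi: "integrable M Y" using Y\<xi>(1)[of 1] assms(15) by simp
    then have Ri: "integrable (\<mu> \<Otimes>\<^sub>M \<nu>) (\<lambda>(x, q). law.RS_integral x q)" by (simp add: Y_iff)
    have meas: "(\<lambda>q. \<integral>x. law.RS_integral x q \<partial>\<mu>) \<in> borel_measurable P" by measurable
    have meas': "(\<lambda>\<omega>. \<integral>x. law.RS_integral x (path \<omega>) \<partial>\<mu>) \<in> borel_measurable M"
      by (rule measurable_compose[OF path meas])
    \<comment> \<open>Integrating out the level by Fubini leaves an integrable function of the path,
      and by \<open>mean\<close> this is D almost surely.\<close>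
    have "integrable M (\<lambda>\<omega>. \<integral>x. law.RS_integral x (path \<omega>) \<partial>\<mu>)"
      using J.integrable_snd[OF Ri] unfolding \<nu>_def by (subst (asm) integrable_distr_eq[OF path meas])
    then have Di: "integrable M D"
      using integrable_cong_AE[OF meas' Dm mean] by simp
    have "integral\<^sup>L M Y = (\<integral>q. \<integral>x. law.RS_integral x q \<partial>\<mu> \<partial>\<nu>)"
      unfolding Y_integral by (rule J.integral_snd[OF Ri, symmetric])
    also have "\<dots> = (\<integral>\<omega>. \<integral>x. law.RS_integral x (path \<omega>) \<partial>\<mu> \<partial>M)"
      unfolding \<nu>_def by (rule integral_distr[OF path meas])
    also have "\<dots> = integral\<^sup>L M D"
      by (rule integral_cong_AE[OF meas' Dm mean])
    finally have YD: "integral\<^sup>L M Y = integral\<^sup>L M D" .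
    have "integral\<^sup>L S (clmc_estimator M L dQ Lmax N \<xi>) = (1 / real N) * (\<Sum>k=1..N. integral\<^sup>L S (\<lambda>\<sigma>. Y (\<xi> k \<sigma>)))"
      unfolding est using Yi Y\<xi>(1) by (subst Bochner_Integration.integral_mult_right_zero) (auto intro!: Bochner_Integration.integral_sum)
    also have "\<dots> = integral\<^sup>L M Y"
      using assms(15) by (simp add: Y\<xi>(2))
    finally show ?thesis using Di YD by simp
  qed
  show ?thesis
    using part1 part2 unfolding D_def by blast
qed

end
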